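(* Let $t\in\mathbb R$ and let $w_t=\frac{1+t}{2}\,u_{11}+\frac{1-t}{2}\,u_{22}\in A_s(4)$, where $u=(u_{ij})$ is the fundamental corepresentation of $A_s(4)$. The Cauchy transform $G$ of the law of $w_t$ is given (for $\xi\in\mathbb C$ with $|\xi|$ sufficiently large) by $$G(\xi)=\frac{1}{2\xi}+\frac{1-2\xi}{\xi-\xi^2}\cdot\frac{\mathrm{arcsinh}(\sqrt x/2)}{\sqrt{4x+x^2}},\qquad x=\frac{1-t^2}{\xi^2-\xi}.$$
   Context: A magic unitary over a $C^*$-algebra $A$ is a square matrix over $A$ whose entries are projections, such that on each row and on each column the entries are pairwise orthogonal and sum up to $1$. $A_s(4)$ is the universal $C^*$-algebra generated by $16$ elements $u_{ij}$ ($1\le i,j\le 4$) with the relations making $u=(u_{ij})$ a magic unitary matrix. It is a Hopf algebra in the sense of Woronowicz, with comultiplication $\Delta(u_{ij})=\sum_k u_{ik}\otimes u_{kj}$. Let $\int:A_s(4)\to\mathbb C$ be its Haar functional, i.e. the unique state which is left and right invariant with respect to $\Delta$. The law of a self-adjoint element $a\in A_s(4)$ is the unique compactly supported probability measure on $\mathbb R$ whose $k$-th moment is $\int a^k$, for all $k\ge 0$. The Cauchy transform of a compactly supported probability measure $\mu$ is $G(\xi)=\int\frac{d\mu(y)}{\xi-y}=\sum_{k\ge0}\xi^{-k-1}\int y^k\,d\mu(y)$ (the series for $|\xi|$ large). The function $x\mapsto \mathrm{arcsinh}(\sqrt x/2)/\sqrt{4x+x^2}$ is understood as the analytic function of $x$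 near $x=0$ which for small $x>0$ is given by this expression with the usual real functions; its value at $x=0$ is $1/4$. *)

theory Defs
  imports
    "HOL-Probability.Probability"
    "HOL-Library.Poly_Mapping"
begin

section \<open>Unital C*-algebras\<close>

class star =
  fixes star :: "'a \<Rightarrow> 'a"

class scaleC =
  fixes scaleC :: "complex \<Rightarrow> 'a \<Rightarrow> 'a"  (infixr \<open>*\<^sub>C\<close> 75)

class cstar_algebra = real_normed_algebra_1 + banach + star + scaleC +
  assumes scaleC_add_right: "c *\<^sub>C (x + y) = c *\<^sub>C x + c *\<^sub>C y"
    and scaleC_add_left: "(c + d) *\<^sub>C x = c *\<^sub>C x + d *\<^sub>C x"
    and scaleC_scaleC: "c *\<^sub>C d *\<^sub>C x = (c * d) *\<^sub>C x"
    and scaleC_of_real: "complex_of_real r *\<^sub>C x = r *\<^sub>R x"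
    and mult_scaleC_left: "(c *\<^sub>C x) * y = c *\<^sub>C (x * y)"
    and mult_scaleC_right: "x * (c *\<^sub>C y) = c *\<^sub>C (x * y)"
    and norm_scaleC: "norm (c *\<^sub>C x) = cmod c * norm x"
    and star_add: "star (x + y) = star x + star y"
    and star_scaleC: "star (c *\<^sub>C x) = cnj c *\<^sub>C star x"
    and star_mult: "star (x * y) = star y * star x"
    and star_star: "star (star x) = x"
    and cstar_identity: "norm (star x * x) = (norm x)\<^sup>2"

instantiation complex :: cstar_algebra
begin

definition star_complex :: "complex \<Rightarrow> complex" where
  "star_complex = cnj"

definition scaleC_complex :: "complex \<Rightarrow> complex \<Rightarrow> complex" where
  "scaleC_complex = (*)"

instance
  by standard
    (auto simp: star_complex_def scaleC_complex_def algebra_simps scaleR_conv_of_real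
      norm_mult power2_eq_square)

end

lemma scaleC_0_left [simp]: "0 *\<^sub>C (x :: 'a :: cstar_algebra) = 0"
  using scaleC_of_real[of 0 x] by simp

lemma scaleC_1_left [simp]: "1 *\<^sub>C (x :: 'a :: cstar_algebra) = x"
  using scaleC_of_real[of 1 x] by simp

definition star_hom :: "('a :: cstar_algebra \<Rightarrow> 'b :: cstar_algebra) \<Rightarrow> bool" where
  "star_hom f \<longleftrightarrow>
     (\<forall>x y. f (x + y) = f x + f y) \<and> (\<forall>c x. f (c *\<^sub>C x) = c *\<^sub>C f x) \<and>
     (\<forall>x y. f (x * y) = f x * f y) \<and> (\<forall>x. f (star x) = star (f x)) \<and> f 1 = 1"

definition state :: "('a :: cstar_algebra \<Rightarrow> complex) \<Rightarrow> bool" where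
  "state h \<longleftrightarrow>
     (\<forall>x y. h (x + y) = h x + h y) \<and> (\<forall>c x. h (c *\<^sub>C x) = c * h x) \<and>
     (\<forall>x. h (star x * x) \<in> \<real>\<^sub>\<ge>\<^sub>0) \<and> h 1 = 1"


section \<open>The free unital *-algebra on a set of generators\<close>

text \<open>Its elements are the finitely supported complex functions on the words in the generators
  and their formal adjoints; the product inherited from \<^theory>\<open>HOL-Library.Poly_Mapping\<close> is the
  convolution with respect to concatenation of words.\<close>

datatype 'g letter = Gen 'g | Adj 'g

datatype 'g word = Word (letters: "'g letter list")

instantiation word :: (type) monoid_add
begin

definition zero_word :: "'a word" where
  "0 = Word []"

definition plus_word :: "'a word \<Rightarrow> 'a word \<Rightarrow> 'a word" where
  "v + w = Word (letters v @ letters w)"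

instance
  by standard (auto simp: zero_word_def plus_word_def)

end

type_synonym 'g free_star_algebra = "'g word \<Rightarrow>\<^sub>0 complex"

primrec letter_star :: "'g letter \<Rightarrow> 'g letter" where
  "letter_star (Gen g) = Adj g"
| "letter_star (Adj g) = Gen g"

definition word_star :: "'g word \<Rightarrow> 'g word" where
  "word_star w = Word (rev (map letter_star (letters w)))"

definition free_star :: "'g free_star_algebra \<Rightarrow> 'g free_star_algebra" where
  "free_star P = (\<Sum>w\<in>Poly_Mapping.keys P.
     Poly_Mapping.single (word_star w) (cnj (Poly_Mapping.lookup P w)))"

definition free_const :: "complex \<Rightarrow> 'g free_star_algebra" where
  "free_const c = Poly_Mapping.single 0 c"

definition free_gen :: "'g \<Rightarrow> 'g free_star_algebra" where
  "free_gen g = Poly_Mapping.single (Word [Gen g]) 1"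

primrec eval_letter :: "('g \<Rightarrow> 'a :: cstar_algebra) \<Rightarrow> 'g letter \<Rightarrow> 'a" where
  "eval_letter u (Gen g) = u g"
| "eval_letter u (Adj g) = star (u g)"

definition eval_word :: "('g \<Rightarrow> 'a :: cstar_algebra) \<Rightarrow> 'g word \<Rightarrow> 'a" where
  "eval_word u w = prod_list (map (eval_letter u) (letters w))"

definition eval_free :: "('g \<Rightarrow> 'a :: cstar_algebra) \<Rightarrow> 'g free_star_algebra \<Rightarrow> 'a" where
  "eval_free u P = (\<Sum>w\<in>Poly_Mapping.keys P. Poly_Mapping.lookup P w *\<^sub>C eval_word u w)"

lemma eval_free_superset:
  assumes "finite S" "Poly_Mapping.keys P \<subseteq> S"
  shows "eval_free u P = (\<Sum>w\<in>S. Poly_Mapping.lookup P w *\<^sub>C eval_word u w)"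
  unfolding eval_free_def
  by (rule sum.mono_neutral_left) (use assms in \<open>auto simp: in_keys_iff\<close>)

lemma eval_free_single: "eval_free u (Poly_Mapping.single w c) = c *\<^sub>C eval_word u w"
  by (subst eval_free_superset[of "{w}"]) auto

lemma eval_free_add: "eval_free u (P + Q) = eval_free u P + eval_free u Q"
proof -
  let ?S = "Poly_Mapping.keys P \<union> Poly_Mapping.keys Q"
  have "Poly_Mapping.keys (P + Q) \<subseteq> ?S"
    by (rule Poly_Mapping.keys_add)
  then show ?thesis
    by (simp add: eval_free_superset[of ?S] lookup_add scaleC_add_left sum.distrib)
qed

lemma eval_free_0: "eval_free u 0 = 0"
  by (simp add: eval_free_def)

lemma eval_free_diff: "eval_free u (P - Q) = eval_free u P - eval_free u Q"
  using eval_free_add[of u "P - Q" Q] by (simp add: algebra_simps)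

lemma eval_free_sum: "eval_free u (sum f S) = (\<Sum>s\<in>S. eval_free u (f s))"
  by (induction S rule: infinite_finite_induct) (auto simp: eval_free_0 eval_free_add)


section \<open>Universal C*-algebras\<close>

definition cstar_seminorm :: "('g free_star_algebra \<Rightarrow> real) \<Rightarrow> bool" where
  "cstar_seminorm p \<longleftrightarrow>
     (\<forall>x. 0 \<le> p x) \<and> (\<forall>x y. p (x + y) \<le> p x + p y) \<and>
     (\<forall>c x. p (free_const c * x) = cmod c * p x) \<and>
     (\<forall>x y. p (x * y) \<le> p x * p y) \<and> (\<forall>x. p (free_star x * x) = (p x)\<^sup>2)"

text \<open>The universal C*-algebra given by generators and relations is the separated completion of the
  free *-algebra in the largest C*-seminorm vanishing on the relations. The predicate says that
  \<open>'a\<close>, with the elements \<open>u g\<close> as generators, is (isomorphic to) this algebra: the relations hold,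
  the *-polynomials in the generators are dense, and the norm of \<open>'a\<close> dominates, hence induces, the
  largest such seminorm. Quantifying over seminorms replaces the quantification over all
  C*-algebras in the universal property, which HOL cannot express.\<close>

definition universal_cstar_algebra ::
    "'g free_star_algebra set \<Rightarrow> ('g \<Rightarrow> 'a :: cstar_algebra) \<Rightarrow> bool" where
  "universal_cstar_algebra R u \<longleftrightarrow>
     (\<forall>r\<in>R. eval_free u r = 0) \<and>
     closure (range (eval_free u)) = UNIV \<and>
     (\<forall>p. cstar_seminorm p \<and> (\<forall>r\<in>R. p r = 0) \<longrightarrow> (\<forall>x. p x \<le> norm (eval_free u x)))"


section \<open>Magic unitaries and the algebra $A_s(n)$\<close>

definition projection :: "'a :: cstar_algebra \<Rightarrow> bool" where
  "projection x \<longleftrightarrow> x * x = x \<and> star x = x"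

definition magic_unitary :: "'a :: cstar_algebra ^ 'n ^ 'n \<Rightarrow> bool" where
  "magic_unitary u \<longleftrightarrow>
     (\<forall>i j. projection (u $ i $ j)) \<and>
     (\<forall>i j k. j \<noteq> k \<longrightarrow> u $ i $ j * u $ i $ k = 0) \<and>
     (\<forall>i j k. j \<noteq> k \<longrightarrow> u $ j $ i * u $ k $ i = 0) \<and>
     (\<forall>i. (\<Sum>j\<in>UNIV. u $ i $ j) = 1) \<and>
     (\<forall>i. (\<Sum>j\<in>UNIV. u $ j $ i) = 1)"

definition magic_relations :: "('n :: finite \<times> 'n) free_star_algebra set" where
  "magic_relations =
     {free_gen (i, j) * free_gen (i, j) - free_gen (i, j) | i j. True} \<union>
     {free_star (free_gen (i, j)) - free_gen (i, j) | i j. True} \<union>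
     {free_gen (i, j) * free_gen (i, k) | i j k. j \<noteq> k} \<union>
     {free_gen (j, i) * free_gen (k, i) | i j k. j \<noteq> k} \<union>
     {(\<Sum>j\<in>UNIV. free_gen (i, j)) - 1 | i. True} \<union>
     {(\<Sum>j\<in>UNIV. free_gen (j, i)) - 1 | i. True}"

abbreviation entries :: "'a ^ 'n ^ 'm \<Rightarrow> 'm \<times> 'n \<Rightarrow> 'a" where
  "entries u \<equiv> \<lambda>(i, j). u $ i $ j"

lemma eval_free_gen: "eval_free u (free_gen g) = u g"
  by (simp add: free_gen_def eval_free_single eval_word_def)

lemma eval_free_gen_mult: "eval_free u (free_gen g * free_gen g') = u g * u g'"
  by (simp add: free_gen_def mult_single eval_free_single eval_word_def plus_word_def)

lemma eval_free_star_gen: "eval_free u (free_star (free_gen g)) = star (u g)"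
  by (simp add: free_gen_def free_star_def word_star_def eval_free_single eval_word_def)

lemma eval_free_1: "eval_free u 1 = 1"
  by (simp add: eval_free_single eval_word_def zero_word_def flip: single_one)

lemma magic_relations_iff_magic_unitary:
  fixes u :: "'a :: cstar_algebra ^ 'n ^ 'n"
  shows "(\<forall>r\<in>magic_relations. eval_free (entries u) r = 0) \<longleftrightarrow> magic_unitary u"
proof -
  have ball1: "(\<forall>r\<in>{f i | i. True}. P r) \<longleftrightarrow> (\<forall>i. P (f i))" for f :: "'x \<Rightarrow> 'y" and P
    by blast
  have ball2: "(\<forall>r\<in>{f i j | i j. True}. P r) \<longleftrightarrow> (\<forall>i j. P (f i j))"
    for f :: "'x \<Rightarrow> 'x \<Rightarrow> 'y" and P
    by blast
  have ball3: "(\<forall>r\<in>{f i j k | i j k. j \<noteq> k}. P r) \<longleftrightarrow> (\<forall>i j k. j \<noteq> k \<longrightarrow> P (f i j k))"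
    for f :: "'x \<Rightarrow> 'x \<Rightarrow> 'x \<Rightarrow> 'y" and P
    by blast
  show ?thesis
    unfolding magic_relations_def magic_unitary_def projection_def ball_Un ball1 ball2 ball3
    by (simp add: eval_free_diff eval_free_gen eval_free_gen_mult eval_free_star_gen
        eval_free_sum eval_free_1 all_conj_distrib)
qed

text \<open>\<open>is_A_s u\<close> says that \<open>'a\<close> is $A_s(n)$, with $n$ the cardinality of \<open>'n\<close>, and \<open>u\<close> its
  fundamental corepresentation.\<close>

definition is_A_s :: "'a :: cstar_algebra ^ 'n ^ 'n \<Rightarrow> bool" where
  "is_A_s u \<longleftrightarrow> universal_cstar_algebra magic_relations (entries u)"


section \<open>Tensor products, comultiplication and the Haar functional\<close>

text \<open>\<open>T a b\<close> is the elementary tensor $a \otimes b$: the elementary tensors span a dense copy of the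
  algebraic tensor product, so \<open>'b\<close> is its completion in some C*-norm. Every C*-norm dominates the
  spatial one, so the slice maps below are bounded whichever norm is used.\<close>

definition cstar_tensor_product ::
    "('a :: cstar_algebra \<Rightarrow> 'a \<Rightarrow> 'b :: cstar_algebra) \<Rightarrow> bool" where
  "cstar_tensor_product T \<longleftrightarrow>
     (\<forall>a a' b. T (a + a') b = T a b + T a' b) \<and>
     (\<forall>a b b'. T a (b + b') = T a b + T a b') \<and>
     (\<forall>c a b. T (c *\<^sub>C a) b = c *\<^sub>C T a b) \<and>
     (\<forall>c a b. T a (c *\<^sub>C b) = c *\<^sub>C T a b) \<and>
     (\<forall>a b a' b'. T a b * T a' b' = T (a * a') (b * b')) \<and>
     (\<forall>a b. star (T a b) = T (star a) (star b)) \<and>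
     T 1 1 = 1 \<and>
     (\<forall>(n :: nat) a b. (\<Sum>i<n. T (a i) (b i)) = 0 \<and>
        (\<forall>c. (\<Sum>i<n. c i *\<^sub>C b i) = 0 \<longrightarrow> (\<forall>i<n. c i = 0)) \<longrightarrow> (\<forall>i<n. a i = 0)) \<and>
     closure (span {T a b | a b. True}) = UNIV"

definition comultiplication ::
    "'a :: cstar_algebra ^ 'n ^ 'n \<Rightarrow> ('a \<Rightarrow> 'a \<Rightarrow> 'b :: cstar_algebra) \<Rightarrow> ('a \<Rightarrow> 'b) \<Rightarrow> bool" where
  "comultiplication u T \<Delta> \<longleftrightarrow>
     star_hom \<Delta> \<and> (\<forall>i j. \<Delta> (u $ i $ j) = (\<Sum>k\<in>UNIV. T (u $ i $ k) (u $ k $ j)))"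

text \<open>The slice maps $h \otimes \mathrm{id}$ and $\mathrm{id} \otimes h$ on the tensor product; by
  density of the elementary tensors there is at most one \<open>S\<close> in each case.\<close>

definition is_slice_left ::
    "('a :: cstar_algebra \<Rightarrow> 'a \<Rightarrow> 'b :: cstar_algebra) \<Rightarrow> ('a \<Rightarrow> complex) \<Rightarrow> ('b \<Rightarrow> 'a) \<Rightarrow> bool" where
  "is_slice_left T h S \<longleftrightarrow> bounded_linear S \<and> (\<forall>a b. S (T a b) = h a *\<^sub>C b)"

definition is_slice_right ::
    "('a :: cstar_algebra \<Rightarrow> 'a \<Rightarrow> 'b :: cstar_algebra) \<Rightarrow> ('a \<Rightarrow> complex) \<Rightarrow> ('b \<Rightarrow> 'a) \<Rightarrow> bool" where
  "is_slice_right T h S \<longleftrightarrow> bounded_linear S \<and> (\<forall>a b. S (T a b) = h b *\<^sub>C a)"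

definition haar_functional ::
    "('a :: cstar_algebra \<Rightarrow> 'a \<Rightarrow> 'b :: cstar_algebra) \<Rightarrow> ('a \<Rightarrow> 'b) \<Rightarrow> ('a \<Rightarrow> complex) \<Rightarrow> bool" where
  "haar_functional T \<Delta> h \<longleftrightarrow>
     state h \<and>
     (\<exists>S. is_slice_left T h S \<and> (\<forall>a. S (\<Delta> a) = h a *\<^sub>C 1)) \<and>
     (\<exists>S. is_slice_right T h S \<and> (\<forall>a. S (\<Delta> a) = h a *\<^sub>C 1))"


section \<open>Laws and Cauchy transforms\<close>

definition compactly_supported :: "real measure \<Rightarrow> bool" where
  "compactly_supported \<mu> \<longleftrightarrow> (\<exists>K. compact K \<and> (AE y in \<mu>. y \<in> K))"

definition is_law :: "('a :: cstar_algebra \<Rightarrow> complex) \<Rightarrow> 'a \<Rightarrow> real measure \<Rightarrow> bool" where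
  "is_law h a \<mu> \<longleftrightarrow>
     prob_space \<mu> \<and> sets \<mu> = sets borel \<and> compactly_supported \<mu> \<and>
     (\<forall>k :: nat. complex_of_real (\<integral>y. y ^ k \<partial>\<mu>) = h (a ^ k))"

definition cauchy_transform :: "real measure \<Rightarrow> complex \<Rightarrow> complex" where
  "cauchy_transform \<mu> \<xi> = (\<integral>y. 1 / (\<xi> - complex_of_real y) \<partial>\<mu>)"

end

theory Submission
  imports Defs "HOL-Complex_Analysis.Conformal_Mappings"
begin

text \<open>Write \<open>p = u\<^sub>1\<^sub>1\<close>, \<open>q = u\<^sub>2\<^sub>2\<close> and \<open>v = u\<^sub>1\<^sub>1 + u\<^sub>1\<^sub>2 + u\<^sub>2\<^sub>1 + u\<^sub>2\<^sub>2 - 1\<close>. Then \<open>p v = v q = p q\<close> and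
  \<open>q v = v p = q p\<close>, so \<open>v\<^sup>2\<close> commutes with \<open>p\<close> and \<open>q\<close>, and \<open>w = w\<^sub>t\<close> satisfies the cubic relation
  \<open>w\<^sup>3 = w\<^sup>2 - (1 - t\<^sup>2) / 4 (1 - v\<^sup>2) w\<close>. This reduces the moments of \<open>w\<close> to those of \<open>v\<close>.

  The element \<open>v\<close> belongs to a triple \<open>v, v', v''\<close> of anticommuting self-adjoint elements with
  \<open>v\<^sup>2 + v'\<^sup>2 + v''\<^sup>2 = 1\<close>, a twisted two-sphere. The universal property of \<open>A\<^sub>s(4)\<close> yields a representation
  on $\mathbb C^2$ for each angle, and the invariance of the Haar functional then says that the moments of
  \<open>v\<close> do not change when \<open>v\<close> is replaced by \<open>cos \<theta> v \<otimes> \<sigma>\<^sub>z + sin \<theta> v' \<otimes> \<sigma>\<^sub>x\<close>. The second order term in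
  \<open>\<theta>\<close> gives a recursion with solution \<open>h (v\<^bsup>2m\<^esup>) = 1 / (2m + 1)\<close>, the moments of a coordinate uniformly
  distributed on \<open>[-1, 1]\<close>. Hence \<open>w\<close> has an atom of mass \<open>1/2\<close> at \<open>0\<close>, and otherwise the law of a random
  eigenvalue of a \<open>2 \<times> 2\<close> matrix with trace \<open>1\<close> and determinant \<open>(1 - t\<^sup>2) (1 - y\<^sup>2) / 4\<close>, where \<open>y\<close> is
  uniform on \<open>[0, 1]\<close>; integrating the resolvent over \<open>y\<close> produces the \<open>arsinh\<close>.\<close>

section \<open>Evaluation and adjoints in the free *-algebra\<close>

text \<open>A finitely supported function is a sum of monomials. The multiplicativity of
  \<open>eval_free\<close> and \<open>matrix_free\<close> is reduced to single words by this
  rule.\<close>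

lemma poly_mapping_single_add_induct [case_names zero single add]:
  fixes P :: "'k \<Rightarrow>\<^sub>0 'c :: comm_monoid_add"
  assumes zero: "Q 0"
    and single: "\<And>k c. Q (Poly_Mapping.single k c)"
    and add: "\<And>P P'. Q P \<Longrightarrow> Q P' \<Longrightarrow> Q (P + P')"
  shows "Q P"
proof -
  have "Q (\<Sum>k\<in>S. Poly_Mapping.single k (Poly_Mapping.lookup P k))" if "finite S" for S
    using that by induction (auto intro: assms)
  moreover have "P = (\<Sum>k\<in>Poly_Mapping.keys P. Poly_Mapping.single k (Poly_Mapping.lookup P k))"
    by (rule poly_mapping_eqI) (simp add: lookup_sum lookup_single when_def in_keys_iff)
  ultimately show ?thesis
    by (metis finite_keys)
qed

lemma eval_word_plus: "eval_word u (v + w) = eval_word u v * eval_word u w"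
  by (simp add: eval_word_def plus_word_def)

lemma scaleC_0_right [simp]: "c *\<^sub>C (0 :: 'a :: cstar_algebra) = 0"
  using scaleC_add_right[of c 0 "0 :: 'a"] by simp

lemma scaleC_sum_left: "(\<Sum>i\<in>I. f i) *\<^sub>C x = (\<Sum>i\<in>I. f i *\<^sub>C (x :: 'a :: cstar_algebra))"
  by (induction I rule: infinite_finite_induct) (simp_all add: scaleC_add_left)

lemma eval_free_mult: "eval_free u (P * Q) = eval_free u P * eval_free u Q"
proof (induction P rule: poly_mapping_single_add_induct)
  case (single v c)
  show ?case
  proof (induction Q rule: poly_mapping_single_add_induct)
    case (single w d)
    show ?case
      by (simp add: mult_single eval_free_single eval_word_plus mult_scaleC_left mult_scaleC_right
          scaleC_scaleC mult.commute)
  qed (simp_all add: eval_free_0 eval_free_add distrib_left)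
qed (simp_all add: eval_free_0 eval_free_add distrib_right)

lemma eval_free_const: "eval_free u (free_const c) = c *\<^sub>C 1"
  by (simp add: free_const_def eval_free_single eval_word_def zero_word_def)

lemma free_star_superset:
  assumes "finite S" "Poly_Mapping.keys P \<subseteq> S"
  shows "free_star P = (\<Sum>w\<in>S. Poly_Mapping.single (word_star w) (cnj (Poly_Mapping.lookup P w)))"
  unfolding free_star_def
  by (rule sum.mono_neutral_left) (use assms in \<open>auto simp: in_keys_iff\<close>)

lemma free_star_single: "free_star (Poly_Mapping.single w c) = Poly_Mapping.single (word_star w) (cnj c)"
  by (subst free_star_superset[of "{w}"]) auto

lemma free_star_0: "free_star 0 = 0"
  by (simp add: free_star_def)

lemma free_star_add: "free_star (P + Q) = free_star P + free_star Q"
proof -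
  let ?S = "Poly_Mapping.keys P \<union> Poly_Mapping.keys Q"
  have "Poly_Mapping.keys (P + Q) \<subseteq> ?S"
    by (rule Poly_Mapping.keys_add)
  then show ?thesis
    by (simp add: free_star_superset[of ?S] lookup_add single_add sum.distrib)
qed

section \<open>Matrix representations of the free *-algebra\<close>

definition adjoint_matrix :: "complex ^ 'n ^ 'm \<Rightarrow> complex ^ 'm ^ 'n" where
  "adjoint_matrix M = (\<chi> i j. cnj (M $ j $ i))"

definition scale_matrix :: "complex \<Rightarrow> complex ^ 'n ^ 'm \<Rightarrow> complex ^ 'n ^ 'm" where
  "scale_matrix c M = (\<chi> i j. c * M $ i $ j)"

primrec matrix_letter :: "('g \<Rightarrow> complex ^ 'n ^ 'n) \<Rightarrow> 'g letter \<Rightarrow> complex ^ 'n ^ 'n" where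
  "matrix_letter R (Gen g) = R g"
| "matrix_letter R (Adj g) = adjoint_matrix (R g)"

text \<open>The multiplication \<open>*\<close> on \<open>complex ^ 'n ^ 'n\<close> is entrywise, so
  the letters are folded with \<open>**\<close> instead of using \<open>prod_list\<close>.\<close>

definition matrix_word :: "('g \<Rightarrow> complex ^ 'n ^ 'n) \<Rightarrow> 'g word \<Rightarrow> complex ^ 'n ^ 'n" where
  "matrix_word R w = foldr (\<lambda>l M. matrix_letter R l ** M) (letters w) (mat 1)"

definition matrix_free ::
    "('g \<Rightarrow> complex ^ 'n ^ 'n) \<Rightarrow> 'g free_star_algebra \<Rightarrow> complex ^ 'n ^ 'n" where
  "matrix_free R P =
     (\<Sum>w\<in>Poly_Mapping.keys P. scale_matrix (Poly_Mapping.lookup P w) (matrix_word R w))"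

lemma adjoint_matrix_mult: "adjoint_matrix (M ** N) = adjoint_matrix N ** adjoint_matrix M"
  by (simp add: adjoint_matrix_def matrix_matrix_mult_def vec_eq_iff mult.commute)

lemma adjoint_matrix_simps [simp]:
  "adjoint_matrix (adjoint_matrix M) = M"
  "adjoint_matrix (mat 1) = mat 1"
  "adjoint_matrix 0 = 0"
  "adjoint_matrix (M + N) = adjoint_matrix M + adjoint_matrix N"
  "adjoint_matrix (scale_matrix c M) = scale_matrix (cnj c) (adjoint_matrix M)"
  by (simp_all add: adjoint_matrix_def scale_matrix_def mat_def vec_eq_iff)

lemma scale_matrix_simps [simp]:
  "scale_matrix 0 M = 0"
  "scale_matrix 1 M = M"
  "scale_matrix c 0 = 0"
  "scale_matrix c (M + N) = scale_matrix c M + scale_matrix c N"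
  "scale_matrix (c + d) M = scale_matrix c M + scale_matrix d M"
  "scale_matrix c (scale_matrix d M) = scale_matrix (c * d) M"
  "scale_matrix c M ** N = scale_matrix c (M ** N)"
  "M ** scale_matrix c N = scale_matrix c (M ** N)"
  by (simp_all add: scale_matrix_def matrix_matrix_mult_def vec_eq_iff algebra_simps sum_distrib_left)

lemma matrix_letter_star: "matrix_letter R (letter_star l) = adjoint_matrix (matrix_letter R l)"
  by (cases l) simp_all

lemma foldr_matrix_mult:
  "foldr (\<lambda>l M. f l ** M) xs N = foldr (\<lambda>l M. f l ** M) xs (mat 1) ** N"
  by (induction xs) (simp_all add: matrix_mul_assoc)

lemma matrix_word_plus: "matrix_word R (v + w) = matrix_word R v ** matrix_word R w"
  by (simp add: matrix_word_def plus_word_def) (rule foldr_matrix_mult)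

lemma matrix_word_star: "matrix_word R (word_star w) = adjoint_matrix (matrix_word R w)"
proof -
  have "foldr (\<lambda>l M. matrix_letter R l ** M) (rev (map letter_star ls)) (mat 1) =
      adjoint_matrix (foldr (\<lambda>l M. matrix_letter R l ** M) ls (mat 1))" for ls
    by (induction ls)
      (simp_all add: adjoint_matrix_mult matrix_letter_star, subst foldr_matrix_mult, simp)
  then show ?thesis
    by (simp add: matrix_word_def word_star_def)
qed

lemma matrix_free_superset:
  assumes "finite S" "Poly_Mapping.keys P \<subseteq> S"
  shows "matrix_free R P = (\<Sum>w\<in>S. scale_matrix (Poly_Mapping.lookup P w) (matrix_word R w))"
  unfolding matrix_free_def
  by (rule sum.mono_neutral_left) (use assms in \<open>auto simp: in_keys_iff\<close>)

lemma matrix_free_single: "matrix_free R (Poly_Mapping.single w c) = scale_matrix c (matrix_word R w)"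
  by (subst matrix_free_superset[of "{w}"]) auto

lemma matrix_free_0: "matrix_free R 0 = 0"
  by (simp add: matrix_free_def)

lemma matrix_free_add: "matrix_free R (P + Q) = matrix_free R P + matrix_free R Q"
proof -
  let ?S = "Poly_Mapping.keys P \<union> Poly_Mapping.keys Q"
  have "Poly_Mapping.keys (P + Q) \<subseteq> ?S"
    by (rule Poly_Mapping.keys_add)
  then show ?thesis
    by (simp add: matrix_free_superset[of ?S] lookup_add sum.distrib)
qed

lemma matrix_free_diff: "matrix_free R (P - Q) = matrix_free R P - matrix_free R Q"
  using matrix_free_add[of R "P - Q" Q] by (simp add: algebra_simps)

lemma matrix_free_sum: "matrix_free R (sum f S) = (\<Sum>s\<in>S. matrix_free R (f s))"
  by (induction S rule: infinite_finite_induct) (auto simp: matrix_free_0 matrix_free_add)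

lemma matrix_free_mult: "matrix_free R (P * Q) = matrix_free R P ** matrix_free R Q"
proof (induction P rule: poly_mapping_single_add_induct)
  case (single v c)
  show ?case
  proof (induction Q rule: poly_mapping_single_add_induct)
    case (single w d)
    show ?case
      by (simp add: mult_single matrix_free_single matrix_word_plus mult.commute)
  qed (simp_all add: matrix_free_0 matrix_free_add distrib_left matrix_add_ldistrib)
qed (simp_all add: matrix_free_0 matrix_free_add distrib_right matrix_matrix_mult_def vec_eq_iff sum.distrib)

lemma matrix_free_star: "matrix_free R (free_star P) = adjoint_matrix (matrix_free R P)"
  by (induction P rule: poly_mapping_single_add_induct)
    (simp_all add: free_star_0 matrix_free_0 free_star_single matrix_free_single matrix_word_star
      free_star_add matrix_free_add)

lemma matrix_free_const: "matrix_free R (free_const c) = scale_matrix c (mat 1)"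
  by (simp add: free_const_def matrix_free_single matrix_word_def zero_word_def)

lemma matrix_free_gen: "matrix_free R (free_gen g) = R g"
  by (simp add: free_gen_def matrix_free_single matrix_word_def)

section \<open>The operator norm of matrices as a C*-norm\<close>

text \<open>On complex vectors \<open>inner\<close> is the real part of the Hermitian product, and
  the conjugate transpose is the adjoint for both.\<close>

lemma inner_matrix_vector_mult:
  fixes x :: "complex ^ 'n" and y :: "complex ^ 'm"
  shows "inner (M *v x) y = inner x (adjoint_matrix M *v y)"
proof -
  have "inner (a * b) c = inner b (cnj a * c)" for a b c :: complex
    by (simp add: inner_complex_def algebra_simps)
  then show ?thesis
    by (simp add: inner_vec_def matrix_vector_mult_def adjoint_matrix_def inner_sum_left
        inner_sum_right sum.swap[of _ "UNIV :: 'm set"])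
qed

text \<open>By Cauchy-Schwarz applied to \<open>inner x ((adjoint_matrix M ** M) *v x)\<close>,
  which is the square of \<open>norm (M *v x)\<close>.\<close>

lemma onorm_adjoint_mult_ge:
  fixes M :: "complex ^ 'n ^ 'n"
  shows "(onorm ((*v) M))\<^sup>2 \<le> onorm ((*v) (adjoint_matrix M ** M))"
proof -
  define N where "N = onorm ((*v) (adjoint_matrix M ** M))"
  have N: "norm ((adjoint_matrix M ** M) *v x) \<le> N * norm x" for x
    unfolding N_def by (intro onorm matrix_vector_mul_bounded_linear)
  have "0 \<le> N"
    unfolding N_def by (intro onorm_pos_le matrix_vector_mul_bounded_linear)
  have "norm (M *v x) \<le> sqrt N * norm x" for x
  proof -
    have "(norm (M *v x))\<^sup>2 = inner x ((adjoint_matrix M ** M) *v x)"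
      by (simp add: power2_norm_eq_inner inner_matrix_vector_mult matrix_vector_mul_assoc)
    also have "\<dots> \<le> norm x * (N * norm x)"
      by (rule order_trans[OF norm_cauchy_schwarz]) (simp add: N mult_left_mono)
    also have "\<dots> = (sqrt N * norm x)\<^sup>2"
      using \<open>0 \<le> N\<close> by (simp add: power_mult_distrib power2_eq_square)
    finally show ?thesis
      by (rule power2_le_imp_le) (use \<open>0 \<le> N\<close> in simp)
  qed
  then have "onorm ((*v) M) \<le> sqrt N"
    by (rule onorm_le)
  then have "(onorm ((*v) M))\<^sup>2 \<le> (sqrt N)\<^sup>2"
    by (intro power_mono onorm_pos_le matrix_vector_mul_bounded_linear)
  then show ?thesis
    using \<open>0 \<le> N\<close> by (simp add: N_def)
qed

lemma onorm_matrix_mult_le: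
  fixes M N :: "complex ^ 'n ^ 'n"
  shows "onorm ((*v) (M ** N)) \<le> onorm ((*v) M) * onorm ((*v) N)"
  using onorm_compose[of "(*v) M" "(*v) N"] by (simp add: o_def matrix_vector_mul_assoc)

text \<open>With M' the adjoint, divide |M|^2 <= |M' M| <= |M'| |M| by |M|. Used for both M and M',
  this gives equality of the norms and then the C*-identity.\<close>

lemma onorm_adjoint_le:
  fixes M :: "complex ^ 'n ^ 'n"
  shows "onorm ((*v) M) \<le> onorm ((*v) (adjoint_matrix M))"
proof (cases "onorm ((*v) M) = 0")
  case False
  then have "onorm ((*v) M) > 0"
    using onorm_pos_le[of "(*v) M"] by simp
  with onorm_adjoint_mult_ge[of M] onorm_matrix_mult_le[of "adjoint_matrix M" M] show ?thesis
    by (simp add: power2_eq_square) (meson dual_order.trans mult_le_cancel_right_pos)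
qed (simp add: onorm_pos_le)

lemma onorm_adjoint_mult:
  fixes M :: "complex ^ 'n ^ 'n"
  shows "onorm ((*v) (adjoint_matrix M ** M)) = (onorm ((*v) M))\<^sup>2"
proof -
  have "onorm ((*v) (adjoint_matrix M)) = onorm ((*v) M)"
    using onorm_adjoint_le[of M] onorm_adjoint_le[of "adjoint_matrix M"] by simp
  with onorm_adjoint_mult_ge[of M] onorm_matrix_mult_le[of "adjoint_matrix M" M] show ?thesis
    by (simp add: power2_eq_square)
qed

lemma onorm_scale_matrix:
  fixes M :: "complex ^ 'n ^ 'n"
  shows "onorm ((*v) (scale_matrix c M)) = cmod c * onorm ((*v) M)"
proof -
  have "norm (scale_matrix c M *v x) = cmod c * norm (M *v x)" for x
    by (simp add: norm_vec_def matrix_vector_mult_def scale_matrix_def mult.assoc norm_mult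
        L2_set_right_distrib flip: sum_distrib_left)
  then have "norm (scale_matrix c M *v x) = norm (cmod c *\<^sub>R (M *v x))" for x
    by simp
  then have "onorm ((*v) (scale_matrix c M)) = onorm (\<lambda>x. cmod c *\<^sub>R (M *v x))"
    by (simp add: onorm_def)
  then show ?thesis
    by (simp add: onorm_scaleR)
qed

text \<open>A matrix representation enters the universal property through its operator norm, pulled
  back to the free algebra.\<close>

lemma cstar_seminorm_matrix_free: "cstar_seminorm (\<lambda>P. onorm ((*v) (matrix_free R P)))"
  unfolding cstar_seminorm_def
proof (intro conjI allI)
  fix P Q :: "'a free_star_algebra"
  show "onorm ((*v) (matrix_free R (P + Q))) \<le>
      onorm ((*v) (matrix_free R P)) + onorm ((*v) (matrix_free R Q))"
    using onorm_triangle[of "(*v) (matrix_free R P)" "(*v) (matrix_free R Q)"]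
    by (simp add: matrix_free_add matrix_vector_mult_add_rdistrib[abs_def])
qed (simp_all add: onorm_pos_le matrix_free_mult matrix_free_const matrix_free_star
    onorm_matrix_mult_le onorm_adjoint_mult onorm_scale_matrix)

text \<open>The pulled back seminorm vanishes on the relations, hence is dominated by
  \<open>norm (eval_free u P)\<close>. Thus the representation is well defined on the polynomials in
  \<open>u\<close>.\<close>

lemma universal_cstar_algebra_matrix_free_eq_0:
  assumes "universal_cstar_algebra \<R> u" "\<And>r. r \<in> \<R> \<Longrightarrow> matrix_free R r = 0" "eval_free u P = 0"
  shows "matrix_free R P = 0"
proof -
  have "onorm ((*v) (matrix_free R r)) = 0" if "r \<in> \<R>" for r
    using assms(2)[OF that] by (simp add: onorm_eq_0)
  then have "onorm ((*v) (matrix_free R P)) \<le> norm (eval_free u P)"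
    using assms(1) cstar_seminorm_matrix_free[of R] unfolding universal_cstar_algebra_def by blast
  then have "onorm ((*v) (matrix_free R P)) = 0"
    using assms(3) onorm_pos_le[of "(*v) (matrix_free R P)"] by simp
  then have "matrix_free R P *v x = 0 *v x" for x
    by (simp add: onorm_eq_0)
  then show ?thesis
    by (simp add: matrix_eq)
qed

lemma matrix_free_magic_relations:
  fixes R :: "'i :: finite \<times> 'i \<Rightarrow> complex ^ 'n ^ 'n"
  assumes "\<And>i j. R (i, j) ** R (i, j) = R (i, j)"
    and "\<And>i j. adjoint_matrix (R (i, j)) = R (i, j)"
    and "\<And>i j k. j \<noteq> k \<Longrightarrow> R (i, j) ** R (i, k) = 0"
    and "\<And>i j k. j \<noteq> k \<Longrightarrow> R (j, i) ** R (k, i) = 0"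
    and "\<And>i. (\<Sum>j\<in>UNIV. R (i, j)) = mat 1"
    and "\<And>i. (\<Sum>j\<in>UNIV. R (j, i)) = mat 1"
    and "r \<in> magic_relations"
  shows "matrix_free R r = 0"
proof -
  have "matrix_free R 1 = mat 1"
    by (simp add: matrix_free_single matrix_word_def zero_word_def flip: single_one)
  with assms show ?thesis
    unfolding magic_relations_def
    by (auto simp: matrix_free_diff matrix_free_mult matrix_free_gen matrix_free_star matrix_free_sum)
qed

section \<open>Invariance of the Haar functional under matrix representations\<close>

definition tensor_matrix :: "'a :: cstar_algebra \<Rightarrow> complex ^ 'n ^ 'm \<Rightarrow> 'a ^ 'n ^ 'm" where
  "tensor_matrix a M = (\<chi> r s. M $ r $ s *\<^sub>C a)"

text \<open>The graph of the (a priori not well-defined) map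
  $\mathrm{id} \otimes \rho : A \otimes A \to A \otimes M_n(\mathbb C)$, where $\rho$ is the
  representation of the polynomials in \<open>u\<close> given by \<open>R\<close>.\<close>

inductive tensor_rep :: "('a :: cstar_algebra \<Rightarrow> 'a \<Rightarrow> 'b :: cstar_algebra) \<Rightarrow> ('g \<Rightarrow> 'a) \<Rightarrow>
    ('g \<Rightarrow> complex ^ 'n ^ 'n) \<Rightarrow> 'b \<Rightarrow> 'a ^ 'n ^ 'n \<Rightarrow> bool"
  for T u R where
  elementary: "tensor_rep T u R (T a (eval_free u P)) (tensor_matrix a (matrix_free R P))"
| add: "tensor_rep T u R x M \<Longrightarrow> tensor_rep T u R y N \<Longrightarrow> tensor_rep T u R (x + y) (M + N)"

lemma tensor_matrix_mult:
  "tensor_matrix a M ** tensor_matrix b N = tensor_matrix (a * b) (M ** N)"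
  by (simp add: tensor_matrix_def matrix_matrix_mult_def vec_eq_iff mult_scaleC_left
      mult_scaleC_right scaleC_scaleC scaleC_sum_left mult.commute)

lemma tensor_matrix_0: "tensor_matrix 0 M = 0"
  by (simp add: tensor_matrix_def vec_eq_iff)

lemma tensor_rep_mult:
  assumes "cstar_tensor_product T" "tensor_rep T u R x M" "tensor_rep T u R y N"
  shows "tensor_rep T u R (x * y) (M ** N)"
  using assms(2)
proof induction
  case (elementary a P)
  from assms(3) show ?case
  proof induction
    case (elementary b Q)
    have "T a (eval_free u P) * T b (eval_free u Q) = T (a * b) (eval_free u (P * Q))"
      using assms(1) by (simp add: cstar_tensor_product_def eval_free_mult)
    moreover have "tensor_matrix a (matrix_free R P) ** tensor_matrix b (matrix_free R Q) =
        tensor_matrix (a * b) (matrix_free R (P * Q))"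
      by (simp add: tensor_matrix_mult matrix_free_mult)
    ultimately show ?case
      by (simp only: tensor_rep.elementary)
  qed (simp add: distrib_left matrix_add_ldistrib tensor_rep.add)
next
  case (add x M x' M')
  have "(M + M') ** N = M ** N + M' ** N"
    by (simp add: matrix_matrix_mult_def vec_eq_iff sum.distrib distrib_right)
  with add show ?case
    by (simp add: distrib_right tensor_rep.add)
qed

lemma tensor_rep_scaleC:
  assumes "cstar_tensor_product T" "tensor_rep T u R x M"
  shows "tensor_rep T u R (c *\<^sub>C x) (\<chi> r s. c *\<^sub>C M $ r $ s)"
  using assms(2)
proof induction
  case (elementary a P)
  have "(\<chi> r s. c *\<^sub>C tensor_matrix a (matrix_free R P) $ r $ s) = tensor_matrix (c *\<^sub>C a) (matrix_free R P)"
    by (simp add: tensor_matrix_def vec_eq_iff scaleC_scaleC mult.commute)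
  moreover have "c *\<^sub>C T a (eval_free u P) = T (c *\<^sub>C a) (eval_free u P)"
    using assms(1) by (simp add: cstar_tensor_product_def)
  ultimately show ?case
    by (simp only: tensor_rep.elementary)
next
  case (add x M y N)
  have "(\<chi> r s. c *\<^sub>C (M + N) $ r $ s) = (\<chi> r s. c *\<^sub>C M $ r $ s) + (\<chi> r s. c *\<^sub>C N $ r $ s)"
    by (simp add: vec_eq_iff scaleC_add_right)
  with add show ?case
    by (simp only: scaleC_add_right tensor_rep.add)
qed

lemma tensor_rep_sum:
  assumes "cstar_tensor_product T" "finite I" "\<And>i. i \<in> I \<Longrightarrow> tensor_rep T u R (x i) (M i)"
  shows "tensor_rep T u R (\<Sum>i\<in>I. x i) (\<Sum>i\<in>I. M i)"
  using assms(2,3)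
proof (induction I)
  case empty
  have "T 0 b = 0" for b
    using assms(1) unfolding cstar_tensor_product_def by (metis add_cancel_right_right)
  then show ?case
    using tensor_rep.elementary[of T u R 0 0] by (simp add: tensor_matrix_0)
qed (simp add: tensor_rep.add)

text \<open>The slice acts on the first leg and the representation on the second, so they commute.
  The polynomial is existential because \<open>matrix_free\<close> acts on the free algebra and not
  on \<open>'a\<close>.\<close>

lemma tensor_rep_slice:
  assumes "is_slice_left T h S" "state h" "tensor_rep T u R x M"
  shows "\<exists>P. S x = eval_free u P \<and> (\<forall>r s. matrix_free R P $ r $ s = h (M $ r $ s))"
  using assms(3)
proof induction
  case (elementary a P)
  have "S (T a (eval_free u P)) = eval_free u (free_const (h a) * P)"
    using assms(1) by (simp add: is_slice_left_def eval_free_mult eval_free_const mult_scaleC_left)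
  moreover have "matrix_free R (free_const (h a) * P) $ r $ s =
      h (tensor_matrix a (matrix_free R P) $ r $ s)" for r s
    using assms(2) by (simp add: state_def tensor_matrix_def matrix_free_mult matrix_free_const)
      (simp add: scale_matrix_def)
  ultimately show ?case by blast
next
  case (add x M y N)
  then obtain P Q where
    "S x = eval_free u P" "\<forall>r s. matrix_free R P $ r $ s = h (M $ r $ s)"
    "S y = eval_free u Q" "\<forall>r s. matrix_free R Q $ r $ s = h (N $ r $ s)"
    by blast
  moreover have "S (x + y) = S x + S y"
    using assms(1) by (simp add: is_slice_left_def linear_simps)
  ultimately show ?case
    using assms(2) by (intro exI[of _ "P + Q"]) (simp add: state_def eval_free_add matrix_free_add)
qed

text \<open>Applying \<open>R\<close> to the invariance identity $(h \otimes \mathrm{id}) \Delta(a) = h(a) 1$.\<close>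

lemma haar_tensor_rep:
  assumes "universal_cstar_algebra \<R> u" "\<And>r. r \<in> \<R> \<Longrightarrow> matrix_free R r = 0"
    and "haar_functional T \<Delta> h" "tensor_rep T u R (\<Delta> a) M"
  shows "h (M $ r $ s) = (if r = s then h a else 0)"
proof -
  obtain S where S: "is_slice_left T h S" "S (\<Delta> a) = h a *\<^sub>C 1" and "state h"
    using assms(3) unfolding haar_functional_def by blast
  obtain P where P: "S (\<Delta> a) = eval_free u P" "\<And>r s. matrix_free R P $ r $ s = h (M $ r $ s)"
    using tensor_rep_slice[OF S(1) \<open>state h\<close> assms(4)] by blast
  \<comment> \<open>\<open>P\<close> and the constant \<open>h a\<close> have the same value at
    \<open>u\<close>, so by the universal property they agree under \<open>R\<close>.\<close>
  have "eval_free u (P - free_const (h a)) = 0"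
    using P(1) S(2) by (simp add: eval_free_diff eval_free_const)
  then have "matrix_free R (P - free_const (h a)) = 0"
    using universal_cstar_algebra_matrix_free_eq_0[OF assms(1,2)] by blast
  then have "matrix_free R P = scale_matrix (h a) (mat 1)"
    by (simp add: matrix_free_diff matrix_free_const)
  then show ?thesis
    unfolding P(2)[symmetric] by (simp add: scale_matrix_def mat_def)
qed

lemma tensor_rep_comultiplication:
  assumes "cstar_tensor_product T" "comultiplication u T \<Delta>"
  shows "tensor_rep T (entries u) R (\<Delta> (u $ i $ j)) (\<Sum>k\<in>UNIV. tensor_matrix (u $ i $ k) (R (k, j)))"
proof -
  have "tensor_rep T (entries u) R (T (u $ i $ k) (u $ k $ j)) (tensor_matrix (u $ i $ k) (R (k, j)))" for k
    using tensor_rep.elementary[of T "entries u" R _ "free_gen (k, j)"]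
    by (simp add: eval_free_gen matrix_free_gen)
  then have "tensor_rep T (entries u) R (\<Sum>k\<in>UNIV. T (u $ i $ k) (u $ k $ j))
      (\<Sum>k\<in>UNIV. tensor_matrix (u $ i $ k) (R (k, j)))"
    by (intro tensor_rep_sum assms(1) finite)
  then show ?thesis
    using assms(2) by (simp add: comultiplication_def)
qed

lemma tensor_rep_one:
  fixes T :: "'a :: cstar_algebra \<Rightarrow> 'a \<Rightarrow> 'b :: cstar_algebra"
  assumes "cstar_tensor_product T"
  shows "tensor_rep T u R 1 (mat 1)"
proof -
  have "tensor_matrix (1 :: 'a) (matrix_free R 1) = mat 1"
    by (simp add: matrix_free_single matrix_word_def zero_word_def tensor_matrix_def mat_def vec_eq_iff
        flip: single_one)
  moreover have "T 1 (eval_free u 1) = 1"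
    using assms by (simp add: cstar_tensor_product_def eval_free_1)
  ultimately show ?thesis
    using tensor_rep.elementary[of T u R 1 1] by (simp only:)
qed

section \<open>The Haar functional of a quantum permutation group\<close>

locale quantum_permutation_haar =
  fixes u :: "'a :: cstar_algebra ^ 'i :: finite ^ 'i"
    and T :: "'a \<Rightarrow> 'a \<Rightarrow> 'b :: cstar_algebra"
    and \<Delta> :: "'a \<Rightarrow> 'b"
    and h :: "'a \<Rightarrow> complex"
  assumes A_s: "is_A_s u"
    and tensor: "cstar_tensor_product T"
    and comult: "comultiplication u T \<Delta>"
    and haar: "haar_functional T \<Delta> h"
begin

lemma haar_add: "h (a + b) = h a + h b"
  and haar_scaleC: "h (c *\<^sub>C a) = c * h a"
  and haar_one: "h 1 = 1"
  using haar by (auto simp: haar_functional_def state_def)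

lemma haar_scaleR: "h (r *\<^sub>R a) = complex_of_real r * h a"
  by (simp flip: scaleC_of_real haar_scaleC)

lemma haar_diff: "h (a - b) = h a - h b"
  using haar_add[of "a - b" b] by simp

lemma haar_0: "h 0 = 0"
  using haar_diff[of 0 0] by simp

lemma haar_minus: "h (- a) = - h a"
  using haar_diff[of 0 a] by (simp add: haar_0)

lemma haar_sum: "h (\<Sum>i\<in>I. f i) = (\<Sum>i\<in>I. h (f i))"
  by (induction I rule: infinite_finite_induct) (simp_all add: haar_0 haar_add)

lemma magic: "magic_unitary u"
  using A_s unfolding is_A_s_def universal_cstar_algebra_def
  by (simp flip: magic_relations_iff_magic_unitary)

lemma comult_simps:
  "\<Delta> (a + b) = \<Delta> a + \<Delta> b" "\<Delta> (a * b) = \<Delta> a * \<Delta> b" "\<Delta> (c *\<^sub>C a) = c *\<^sub>C \<Delta> a" "\<Delta> 1 = 1"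
  using comult by (auto simp: comultiplication_def star_hom_def)

text \<open>\<open>M\<close> arises from \<open>\<Delta> a\<close> by applying the representation
  given by \<open>R\<close> to the second leg.\<close>

abbreviation coact :: "('i \<times> 'i \<Rightarrow> complex ^ 'n ^ 'n) \<Rightarrow> 'a \<Rightarrow> 'a ^ 'n ^ 'n \<Rightarrow> bool" where
  "coact R a M \<equiv> tensor_rep T (entries u) R (\<Delta> a) M"

lemma coact_intros:
  "coact R 1 (mat 1)"
  "coact R (u $ i $ j) (\<Sum>k\<in>UNIV. tensor_matrix (u $ i $ k) (R (k, j)))"
  "coact R a M \<Longrightarrow> coact R b N \<Longrightarrow> coact R (a + b) (M + N)"
  "coact R a M \<Longrightarrow> coact R b N \<Longrightarrow> coact R (a * b) (M ** N)"
  "coact R a M \<Longrightarrow> coact R (c *\<^sub>C a) (\<chi> r s. c *\<^sub>C M $ r $ s)"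
  using tensor comult
  by (simp_all add: comult_simps tensor_rep_one tensor_rep_comultiplication tensor_rep.add
      tensor_rep_mult tensor_rep_scaleC)

lemma coact_diff:
  assumes "coact R a M" "coact R b N"
  shows "coact R (a - b) (M - N)"
proof -
  have minus: "(-1) *\<^sub>C x = - x" for x :: 'a
    using scaleC_of_real[of "-1" x] by simp
  have "coact R (a + (-1) *\<^sub>C b) (M + (\<chi> r s. (-1) *\<^sub>C N $ r $ s))"
    by (intro coact_intros assms)
  moreover have "M + (\<chi> r s. (-1) *\<^sub>C N $ r $ s) = M - N"
    unfolding minus by (simp add: vec_eq_iff)
  ultimately show ?thesis
    unfolding minus by simp
qed

lemma haar_coact:
  assumes "\<And>r. r \<in> magic_relations \<Longrightarrow> matrix_free R r = 0" "coact R a M"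
  shows "h (M $ r $ s) = (if r = s then h a else 0)"
  using haar_tensor_rep[OF _ assms(1) haar assms(2)] A_s unfolding is_A_s_def by blast

section \<open>Invariance under permutations of the columns\<close>

text \<open>The graph of the substitution that permutes the columns in polynomials in
  \<open>u\<close>; as a relation it does not presuppose an automorphism of
  \<open>'a\<close>.\<close>

inductive column_permuted :: "('i \<Rightarrow> 'i) \<Rightarrow> 'a \<Rightarrow> 'a \<Rightarrow> bool" for \<sigma> where
  one: "column_permuted \<sigma> 1 1"
| entry: "column_permuted \<sigma> (u $ i $ j) (u $ i $ \<sigma> j)"
| add: "column_permuted \<sigma> a a' \<Longrightarrow> column_permuted \<sigma> b b' \<Longrightarrow> column_permuted \<sigma> (a + b) (a' + b')"
| diff: "column_permuted \<sigma> a a' \<Longrightarrow> column_permuted \<sigma> b b' \<Longrightarrow> column_permuted \<sigma> (a - b) (a' - b')"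
| mult: "column_permuted \<sigma> a a' \<Longrightarrow> column_permuted \<sigma> b b' \<Longrightarrow> column_permuted \<sigma> (a * b) (a' * b')"

lemma column_permuted_power: "column_permuted \<sigma> a a' \<Longrightarrow> column_permuted \<sigma> (a ^ n) (a' ^ n)"
  by (induction n) (simp_all add: column_permuted.one column_permuted.mult)

text \<open>The permutation matrix of \<sigma> with 1 x 1 blocks is a magic unitary, hence gives a
  character. Applied to the second leg of the comultiplication, it performs the substitution, and
  the invariance of \<open>h\<close> yields the claim.\<close>

lemma haar_column_permuted:
  assumes "column_permuted \<sigma> a b" "bij \<sigma>"
  shows "h b = h a"
proof -
  define R :: "'i \<times> 'i \<Rightarrow> complex ^ 1 ^ 1" where "R = (\<lambda>(k, j). if k = \<sigma> j then mat 1 else 0)"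
  have R_0: "matrix_free R r = 0" if "r \<in> magic_relations" for r
  proof (rule matrix_free_magic_relations[OF _ _ _ _ _ _ that])
    have inj: "\<sigma> i = \<sigma> j \<longleftrightarrow> i = j" for i j
      using \<open>bij \<sigma>\<close> by (simp add: bij_def inj_eq)
    have inv: "i = \<sigma> j \<longleftrightarrow> j = inv \<sigma> i" for i j
      using \<open>bij \<sigma>\<close> by (metis bij_inv_eq_iff)
    show "(\<Sum>j\<in>UNIV. R (i, j)) = mat 1" for i
      by (simp add: R_def inv)
    show "(\<Sum>j\<in>UNIV. R (j, i)) = mat 1" for i
      by (simp add: R_def)
    show "R (i, j) ** R (i, k) = 0" if "j \<noteq> k" for i j k
      using that inj[of j k] by (auto simp: R_def)
  qed (auto simp: R_def)
  from assms(1) have "\<exists>M. coact R a M \<and> M $ 1 $ 1 = b"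
  proof induction
    case one
    show ?case
      by (intro exI[of _ "mat 1"] conjI coact_intros) (simp add: mat_def)
  next
    case (entry i j)
    have "(\<Sum>k\<in>UNIV. tensor_matrix (u $ i $ k) (R (k, j))) $ 1 $ 1 =
        (\<Sum>k\<in>UNIV. if k = \<sigma> j then u $ i $ k else 0)"
      unfolding sum_component by (intro sum.cong) (auto simp: R_def tensor_matrix_def mat_def)
    then show ?case
      using coact_intros(2)[of R i j] by auto
  next
    case (add a a' b b')
    then show ?case by (metis coact_intros(3) vector_add_component)
  next
    case (diff a a' b b')
    then show ?case by (metis coact_diff vector_minus_component)
  next
    case (mult a a' b b')
    then obtain M N where "coact R a M" "coact R b N" "M $ 1 $ 1 = a'" "N $ 1 $ 1 = b'"
      by blast
    then show ?case
      by (intro exI[of _ "M ** N"] conjI coact_intros) (simp_all add: matrix_matrix_mult_def sum_1)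
  qed
  then show ?thesis
    using haar_coact[OF R_0, of a _ 1 1] by auto
qed

end

section \<open>Binomial expansions for anticommuting elements\<close>

lemma sum_Suc_choose:
  fixes g :: "nat \<Rightarrow> 'a :: ring_1"
  shows "(\<Sum>j\<le>Suc n. of_nat (Suc n choose j) * g j) =
    (\<Sum>j\<le>n. of_nat (n choose j) * g j) + (\<Sum>j\<le>n. of_nat (n choose j) * g (Suc j))"
proof -
  have "(\<Sum>j\<le>n. of_nat (n choose j) * g j) = (\<Sum>j\<le>Suc n. of_nat (n choose j) * g j)"
    by (simp add: binomial_eq_0)
  also have "\<dots> = g 0 + (\<Sum>j\<le>n. of_nat (n choose Suc j) * g (Suc j))"
    by (subst sum.atMost_Suc_shift) simp
  finally show ?thesis
    by (subst sum.atMost_Suc_shift) (simp add: algebra_simps sum.distrib)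
qed

lemma mult_of_nat_left_commute: "x * (of_nat n * y) = of_nat n * (x * (y :: 'a :: semiring_1))"
  by (simp only: mult.assoc[symmetric] mult_of_nat_commute[of n x])

lemma mult_minus_one_power_left_commute: "x * ((-1) ^ n * y) = (-1) ^ n * (x * (y :: 'a :: ring_1))"
  by (cases "even n") simp_all

lemma anticommute_power:
  fixes X Y :: "'a :: ring_1"
  assumes "Y * X = - (X * Y)"
  shows "Y * X ^ k = (-1) ^ k * X ^ k * Y"
proof (induction k)
  case (Suc k)
  have "Y * X ^ Suc k = - (X * (Y * X ^ k))"
    by (simp add: assms flip: mult.assoc)
  also have "\<dots> = (-1) ^ Suc k * X ^ Suc k * Y"
    by (simp add: Suc.IH mult.assoc mult_minus_one_power_left_commute)
  finally show ?case .
qed simp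

text \<open>The two sums are the first column of the \<open>n\<close>-th power of the matrix with rows
  \<open>(X, Y)\<close> and \<open>(Y, -X)\<close>, which is $X \otimes \sigma_z + Y \otimes \sigma_x$; the two summands
  commute.\<close>

definition even_binomial :: "'a :: ring_1 \<Rightarrow> 'a \<Rightarrow> nat \<Rightarrow> 'a" where
  "even_binomial X Y n =
     (\<Sum>j\<le>n. of_nat (n choose j) * (if even j then X ^ (n - j) * Y ^ j else 0))"

definition odd_binomial :: "'a :: ring_1 \<Rightarrow> 'a \<Rightarrow> nat \<Rightarrow> 'a" where
  "odd_binomial X Y n =
     (\<Sum>j\<le>n. of_nat (n choose j) * (if odd j then (-1) ^ (n - j) * X ^ (n - j) * Y ^ j else 0))"

text \<open>One multiplication by the matrix with rows (X, Y) and (Y, -X). Pascal's rule splits the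
  left sides, and moving \<open>Y\<close> past a power of \<open>X\<close> accounts for the signs in
  \<open>odd_binomial\<close>.\<close>

lemma anticommuting_binomial_Suc:
  fixes X Y :: "'a :: ring_1"
  assumes "Y * X = - (X * Y)"
  shows "even_binomial X Y (Suc n) = X * even_binomial X Y n + Y * odd_binomial X Y n"
    and "odd_binomial X Y (Suc n) = Y * even_binomial X Y n - X * odd_binomial X Y n"
proof -
  have Y: "Y * (X ^ k * y) = (-1) ^ k * (X ^ k * (Y * y))" for k y
    using anticommute_power[OF assms, of k] by (simp flip: mult.assoc)
  have sq: "(-1) ^ k * ((-1) ^ k * y) = (y :: 'a)" for k y
    by (cases "even k") simp_all
  show "even_binomial X Y (Suc n) = X * even_binomial X Y n + Y * odd_binomial X Y n"
    unfolding even_binomial_def odd_binomial_def sum_Suc_choose sum_distrib_left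
    by (intro arg_cong2[of _ _ _ _ "(+)"] sum.cong refl)
      (auto simp: mult_of_nat_left_commute[of X] mult_of_nat_left_commute[of Y]
        mult_minus_one_power_left_commute[of X] mult_minus_one_power_left_commute[of Y] Suc_diff_le mult.assoc Y sq)
  show "odd_binomial X Y (Suc n) = Y * even_binomial X Y n - X * odd_binomial X Y n"
    unfolding even_binomial_def odd_binomial_def sum_Suc_choose sum_distrib_left
      diff_conv_add_uminus sum_negf[symmetric] add.commute[of "sum _ _" "sum (\<lambda>j. - _ j) _"]
    by (intro arg_cong2[of _ _ _ _ "(+)"] sum.cong refl)
      (auto simp: mult_of_nat_left_commute[of X] mult_of_nat_left_commute[of Y]
        mult_minus_one_power_left_commute[of X] mult_minus_one_power_left_commute[of Y] Suc_diff_le mult.assoc Y sq)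
qed

text \<open>Two complex polynomials that agree at the infinitely many real points are equal, so
  their coefficients of degree 2 can be compared.\<close>

lemma coefficient_2_of_power_series_identity:
  fixes c :: "nat \<Rightarrow> complex"
  assumes "\<And>s :: real. (\<Sum>j\<le>N. c j * of_real s ^ j) = \<kappa> * (1 + (of_real s)\<^sup>2) ^ m" "2 \<le> N"
  shows "c 2 = of_nat m * \<kappa>"
proof -
  define P where "P = (\<Sum>j\<le>N. monom (c j) j)"
  define Q where "Q = (\<Sum>i\<le>m. monom (\<kappa> * of_nat (m choose i)) (2 * i))"
  have "poly P (of_real s) = poly Q (of_real s)" for s :: real
  proof -
    have "poly Q (of_real s) = \<kappa> * ((of_real s)\<^sup>2 + 1) ^ m"
      unfolding binomial_ring by (simp add: Q_def poly_sum poly_monom sum_distrib_left power_mult mult.assoc)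
    then show ?thesis
      using assms(1)[of s] by (simp add: P_def poly_sum poly_monom add.commute)
  qed
  then have "range complex_of_real \<subseteq> {x. poly (P - Q) x = 0}"
    by auto
  moreover have "infinite (range complex_of_real)"
    using range_inj_infinite inj_of_real infinite_UNIV_char_0 finite_imageD by blast
  ultimately have "P - Q = 0"
    using poly_roots_finite[of "P - Q"] finite_subset by blast
  then have "coeff P 2 = coeff Q 2"
    by simp
  also have "coeff Q 2 = (\<Sum>i\<le>m. if i = 1 then \<kappa> * of_nat (m choose i) else 0)"
    unfolding Q_def coeff_sum by (intro sum.cong) auto
  also have "\<dots> = of_nat m * \<kappa>"
    by simp
  finally show ?thesis
    using assms(2) by (simp add: P_def coeff_sum)
qed

section \<open>Four points\<close>

text \<open>In Pauli matrices this is (1 + c \<sigma>_z + s \<sigma>_x) / 2, a projection of rank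
  one when (c, s) lies on the unit circle.\<close>

definition rotation_projection :: "real \<Rightarrow> real \<Rightarrow> complex ^ 2 ^ 2" where
  "rotation_projection c s =
     (\<chi> i j. of_real (if i = j then if i = 1 then (1 + c) / 2 else (1 - c) / 2 else s / 2))"

text \<open>The blocks are chosen so that the induced coaction rotates the vectors \<open>v 2\<close> and \<open>v 3\<close> below
  into each other and fixes \<open>v 4\<close>.\<close>

definition rotation_rep :: "real \<Rightarrow> real \<Rightarrow> 4 \<times> 4 \<Rightarrow> complex ^ 2 ^ 2" where
  "rotation_rep c s = (\<lambda>(i, j).
     if i \<in> {1, 4} \<and> j \<in> {1, 4} then
       if i = j then rotation_projection c s else rotation_projection (- c) (- s)
     else if i \<in> {2, 3} \<and> j \<in> {2, 3} then
       if i = j then rotation_projection c (- s) else rotation_projection (- c) s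
     else 0)"

lemma rotation_projection_simps:
  assumes "c\<^sup>2 + s\<^sup>2 = 1"
  shows "rotation_projection c s ** rotation_projection c s = rotation_projection c s"
    and "rotation_projection c s ** rotation_projection (- c) (- s) = 0"
    and "adjoint_matrix (rotation_projection c s) = rotation_projection c s"
    and "rotation_projection c s + rotation_projection (- c) (- s) = mat 1"
proof -
  have *: "complex_of_real s * complex_of_real s = 1 - complex_of_real c * complex_of_real c"
    using arg_cong[OF assms, of complex_of_real] by (simp add: power2_eq_square algebra_simps)
  show "rotation_projection c s ** rotation_projection c s = rotation_projection c s"
    "rotation_projection c s ** rotation_projection (- c) (- s) = 0"
    "adjoint_matrix (rotation_projection c s) = rotation_projection c s"
    "rotation_projection c s + rotation_projection (- c) (- s) = mat 1"
    by (auto simp: rotation_projection_def matrix_matrix_mult_def sum_2 vec_eq_iff forall_2 * mat_def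
        adjoint_matrix_def field_simps)
qed

text \<open>Negating \<open>c\<close> and \<open>s\<close> turns a projection P into 1 - P. On the
  index sets {1, 4} and {2, 3} the matrix is therefore a magic block with P on the diagonal and 1 -
  P off it.\<close>

lemma rotation_rep_magic_relations:
  assumes "c\<^sup>2 + s\<^sup>2 = 1" "r \<in> magic_relations"
  shows "matrix_free (rotation_rep c s) r = 0"
proof -
  have neg: "(- c)\<^sup>2 + s\<^sup>2 = 1" "c\<^sup>2 + (- s)\<^sup>2 = 1" "(- c)\<^sup>2 + (- s)\<^sup>2 = 1"
    using assms(1) by simp_all
  note P = rotation_projection_simps[OF assms(1)] rotation_projection_simps[OF neg(1), simplified]
    rotation_projection_simps[OF neg(2), simplified] rotation_projection_simps[OF neg(3), simplified]
  have *: "\<forall>i j. rotation_rep c s (i, j) ** rotation_rep c s (i, j) = rotation_rep c s (i, j)"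
    "\<forall>i j. adjoint_matrix (rotation_rep c s (i, j)) = rotation_rep c s (i, j)"
    "\<forall>i j k. j \<noteq> k \<longrightarrow> rotation_rep c s (i, j) ** rotation_rep c s (i, k) = 0"
    "\<forall>i j k. j \<noteq> k \<longrightarrow> rotation_rep c s (j, i) ** rotation_rep c s (k, i) = 0"
    "\<forall>i. (\<Sum>j\<in>UNIV. rotation_rep c s (i, j)) = mat 1"
    "\<forall>i. (\<Sum>j\<in>UNIV. rotation_rep c s (j, i)) = mat 1"
    unfolding forall_4 sum_4 by (simp_all add: rotation_rep_def P add.commute)
  show ?thesis
    by (rule matrix_free_magic_relations[OF *(1,2)[rule_format] *(3,4)[rule_format]
          *(5,6)[rule_format] assms(2)])
qed

text \<open>Eliminating \<open>d\<close> turns its idempotency into one quadratic relation among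
  \<open>a\<close>, \<open>b\<close>, \<open>c\<close>. Solved for \<open>b * c\<close>, it serves
  as a rewrite rule that proves both identities.\<close>

lemma four_projections_sum_2:
  fixes a b c d :: "'a :: ring_1"
  assumes "a * a = a" "b * b = b" "c * c = c" "d * d = d" "a + b + c + d = 2"
  shows "(a + c - 1) * (a + b - 1) = - ((a + b - 1) * (a + c - 1))"
    and "(a + b - 1) * (a + b - 1) + (a + c - 1) * (a + c - 1) + (a + d - 1) * (a + d - 1) = 1"
proof -
  have d: "d = 1 + 1 - a - b - c"
    using assms(5) by (simp add: algebra_simps)
  have "a * b + b * a + a * c + c * a + b * c + c * b - (a + a + b + b + c + c - 1 - 1) = d * d - d"
    using assms(1-3) unfolding d by (simp add: algebra_simps mult_2 mult_2_right)
  then have bc: "b * c = a + a + b + b + c + c - 1 - 1 - (a * b + b * a + a * c + c * a + c * b)"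
    using assms(4) by (simp add: algebra_simps)
  show "(a + c - 1) * (a + b - 1) = - ((a + b - 1) * (a + c - 1))"
    using assms(1-3) by (simp add: algebra_simps bc)
  show "(a + b - 1) * (a + b - 1) + (a + c - 1) * (a + c - 1) + (a + d - 1) * (a + d - 1) = 1"
    using assms(1-3) unfolding d by (simp add: algebra_simps mult_2 mult_2_right bc)
qed

locale quantum_permutation_haar_4 = quantum_permutation_haar u T \<Delta> h
  for u :: "'a :: cstar_algebra ^ 4 ^ 4"
    and T :: "'a \<Rightarrow> 'a \<Rightarrow> 'b :: cstar_algebra"
    and \<Delta> :: "'a \<Rightarrow> 'b"
    and h :: "'a \<Rightarrow> complex"
begin

text \<open>In the basis of characters of the Klein four-group, \<open>u\<close> is the direct sum of the trivial
  corepresentation and a \<open>3 \<times> 3\<close> matrix. Its first row is \<open>(v 2, v 3, v 4)\<close>.\<close>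

definition r :: "4 \<Rightarrow> 'a" where
  "r j = u $ 1 $ j + u $ 2 $ j"

definition v :: "4 \<Rightarrow> 'a" where
  "v j = r 1 + r j - 1"

lemma u_simps:
  "u $ i $ j * u $ i $ j = u $ i $ j"
  "j \<noteq> k \<Longrightarrow> u $ i $ j * u $ i $ k = 0"
  "j \<noteq> k \<Longrightarrow> u $ j $ i * u $ k $ i = 0"
  "u $ i $ 1 + u $ i $ 2 + u $ i $ 3 + u $ i $ 4 = 1"
  using magic by (auto simp: magic_unitary_def projection_def sum_4)

lemma r_idem: "r j * r j = r j"
  by (simp add: r_def algebra_simps u_simps)

lemma r_sum: "r 1 + r 2 + r 3 + r 4 = 2"
proof -
  have "r 1 + r 2 + r 3 + r 4 = (u $ 1 $ 1 + u $ 1 $ 2 + u $ 1 $ 3 + u $ 1 $ 4) +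
      (u $ 2 $ 1 + u $ 2 $ 2 + u $ 2 $ 3 + u $ 2 $ 4)"
    by (simp add: r_def)
  then show ?thesis
    by (simp add: u_simps(4))
qed

lemma v_anticommute: "v 3 * v 2 = - (v 2 * v 3)"
  and v_squares: "v 2 * v 2 + v 3 * v 3 + v 4 * v 4 = 1"
  using four_projections_sum_2[OF r_idem r_idem r_idem r_idem r_sum] by (simp_all add: v_def)

text \<open>The summands \<open>u $ 1 $ 2\<close> and \<open>u $ 2 $ 1\<close> of \<open>v 2\<close>
  share a row or a column with each diagonal entry, so these products vanish.\<close>

lemma v_mult:
  "u $ 1 $ 1 * v 2 = u $ 1 $ 1 * u $ 2 $ 2" "u $ 2 $ 2 * v 2 = u $ 2 $ 2 * u $ 1 $ 1"
  "v 2 * u $ 1 $ 1 = u $ 2 $ 2 * u $ 1 $ 1" "v 2 * u $ 2 $ 2 = u $ 1 $ 1 * u $ 2 $ 2"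
  by (simp_all add: v_def r_def algebra_simps u_simps)

section \<open>Column symmetries of the moments\<close>

lemma column_permuted_r: "column_permuted \<sigma> (r j) (r (\<sigma> j))"
  unfolding r_def by (intro column_permuted.intros)

lemma column_permuted_v: "column_permuted \<sigma> (v j) (r (\<sigma> 1) + r (\<sigma> j) - 1)"
  unfolding v_def by (intro column_permuted.intros column_permuted_r)

text \<open>Three column involutions are used: (34) fixes \<open>v 2\<close> and exchanges
  \<open>v 3\<close> with \<open>v 4\<close>; (12)(34) fixes \<open>v 2\<close>; (13)(24) sends
  \<open>v 2\<close> to its negative, because the four \<open>r j\<close> sum to 2.\<close>

lemma haar_swap:
  "h (v 2 ^ n * v 4 ^ k) = h (v 2 ^ n * v 3 ^ k)"
  "h (v 2 ^ n * u $ i $ 2) = h (v 2 ^ n * u $ i $ 1)"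
  "h (v 2 ^ n * u $ i $ 4) = h (v 2 ^ n * u $ i $ 3)"
  "h (v 2 ^ n * u $ i $ 3) = (-1) ^ n * h (v 2 ^ n * u $ i $ 1)"
  "h (v 2 ^ n) = (-1) ^ n * h (v 2 ^ n)"
proof -
  have bij: "bij \<sigma>" if "\<forall>j. \<sigma> (\<sigma> j) = j" for \<sigma> :: "4 \<Rightarrow> 4"
    using that by (intro o_bij[of \<sigma>]) (auto simp: fun_eq_iff)
  define s34 s12 s13 :: "4 \<Rightarrow> 4" where
    "s34 = (\<lambda>j. if j = 3 then 4 else if j = 4 then 3 else j)" and
    "s12 = (\<lambda>j. if j = 1 then 2 else if j = 2 then 1 else if j = 3 then 4 else 3)" and
    "s13 = (\<lambda>j. if j = 1 then 3 else if j = 3 then 1 else if j = 2 then 4 else 2)"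
  have bijs: "bij s34" "bij s12" "bij s13"
    by (rule bij; simp add: forall_4 s34_def s12_def s13_def)+
  have v34: "column_permuted s34 (v 2) (v 2)" "column_permuted s34 (v 3) (v 4)"
    using column_permuted_v[of s34 2] column_permuted_v[of s34 3] by (simp_all add: s34_def v_def)
  have v12: "column_permuted s12 (v 2) (v 2)"
    using column_permuted_v[of s12 2] by (simp add: s12_def v_def add.commute)
  have "r 3 + r 4 - 1 = - v 2"
    using r_sum by (simp add: v_def algebra_simps)
  then have v13: "column_permuted s13 (v 2) (- v 2)"
    using column_permuted_v[of s13 2] by (simp add: s13_def)
  show "h (v 2 ^ n * v 4 ^ k) = h (v 2 ^ n * v 3 ^ k)"
    by (rule haar_column_permuted[OF _ bijs(1)]) (intro column_permuted.mult column_permuted_power v34)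
  have e12: "column_permuted s12 (u $ i $ 1) (u $ i $ 2)" "column_permuted s12 (u $ i $ 3) (u $ i $ 4)"
    using column_permuted.entry[of s12 i 1] column_permuted.entry[of s12 i 3] by (simp_all add: s12_def)
  have e13: "column_permuted s13 (u $ i $ 1) (u $ i $ 3)"
    using column_permuted.entry[of s13 i 1] by (simp add: s13_def)
  show "h (v 2 ^ n * u $ i $ 2) = h (v 2 ^ n * u $ i $ 1)"
    "h (v 2 ^ n * u $ i $ 4) = h (v 2 ^ n * u $ i $ 3)"
    by (rule haar_column_permuted[OF _ bijs(2)], intro column_permuted.mult column_permuted_power v12 e12)+
  have minus: "(- v 2) ^ n = (if even n then v 2 ^ n else - (v 2 ^ n))"
    by simp
  have "h ((- v 2) ^ n * u $ i $ 3) = h (v 2 ^ n * u $ i $ 1)"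
    by (rule haar_column_permuted[OF _ bijs(3)]) (intro column_permuted.mult column_permuted_power v13 e13)
  then show "h (v 2 ^ n * u $ i $ 3) = (-1) ^ n * h (v 2 ^ n * u $ i $ 1)"
    by (cases "even n") (auto simp: haar_minus eq_neg_iff_add_eq_0 neg_eq_iff_add_eq_0 add.commute)
  have "h ((- v 2) ^ n) = h (v 2 ^ n)"
    by (rule haar_column_permuted[OF _ bijs(3)]) (intro column_permuted_power v13)
  then show "h (v 2 ^ n) = (-1) ^ n * h (v 2 ^ n)"
    by (cases "even n") (auto simp: haar_minus)
qed

section \<open>Rotation invariance and the moments of \<open>v 2\<close>\<close>

text \<open>The coaction replaces \<open>r j\<close> by the sum of the \<open>r k\<close> tensored
  with the blocks \<open>(k, j)\<close>. Since the \<open>r k\<close> sum to 2, the \<sigma>_z part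
  is \<open>c *\<^sub>R v 2\<close>, the \<sigma>_x part is \<open>s *\<^sub>R v 3\<close>, and the
  identity part cancels.\<close>

lemma coact_rotation_v:
  "\<exists>V. coact (rotation_rep c s) (v 2) V \<and> V $ 1 $ 1 = c *\<^sub>R v 2 \<and> V $ 1 $ 2 = s *\<^sub>R v 3 \<and>
     V $ 2 $ 1 = s *\<^sub>R v 3 \<and> V $ 2 $ 2 = - (c *\<^sub>R v 2)"
proof -
  let ?R = "rotation_rep c s"
  define W where "W j = (\<Sum>k\<in>UNIV. tensor_matrix (u $ 1 $ k) (?R (k, j))) +
    (\<Sum>k\<in>UNIV. tensor_matrix (u $ 2 $ k) (?R (k, j)))" for j
  have W: "W j $ a $ b = (\<Sum>k\<in>UNIV. ?R (k, j) $ a $ b *\<^sub>C r k)" for j a b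
    by (simp add: W_def r_def tensor_matrix_def scaleC_add_right sum.distrib)
  have coact: "coact ?R (v 2) (W 1 + W 2 - mat 1)"
    unfolding v_def r_def W_def by (intro coact_diff coact_intros)
  have sum: "(x / 2) *\<^sub>R r 1 + (x / 2) *\<^sub>R r 2 + (x / 2) *\<^sub>R r 3 + (x / 2) *\<^sub>R r 4 = x *\<^sub>R 1" for x
  proof -
    have "(2 :: 'a) = 2 *\<^sub>R 1"
      by (simp add: scaleR_2)
    then have "(x / 2) *\<^sub>R (2 :: 'a) = x *\<^sub>R 1"
      by (metis nonzero_eq_divide_eq scaleR_scaleR zero_neq_numeral)
    then show ?thesis
      by (simp add: r_sum flip: scaleR_add_right)
  qed
  have split: "((1 + c) / 2) *\<^sub>R (x :: 'a) = ((1 - c) / 2) *\<^sub>R x + c *\<^sub>R x"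
    "(- s / 2) *\<^sub>R x = (s / 2) *\<^sub>R x - s *\<^sub>R x" for x c s
    by (simp_all add: field_simps flip: scaleR_add_left scaleR_diff_left)
  \<comment> \<open>Each scalar has to stay inside a single \<open>of_real\<close> for
    \<open>scaleC_of_real\<close> to apply.\<close>
  note [simp del] = of_real_add of_real_diff of_real_minus of_real_divide
  have "(W 1 + W 2 - mat 1) $ 1 $ 1 = ((1 + c) / 2) *\<^sub>R r 1 + ((1 + c) / 2) *\<^sub>R r 2 +
      ((1 - c) / 2) *\<^sub>R r 3 + ((1 - c) / 2) *\<^sub>R r 4 - 1"
    by (simp add: W sum_4 rotation_rep_def rotation_projection_def scaleC_of_real mat_def)
  also have "\<dots> = c *\<^sub>R v 2"
    using sum[of "1 - c"] by (simp add: split(1) v_def algebra_simps)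
  finally have V11: "(W 1 + W 2 - mat 1) $ 1 $ 1 = c *\<^sub>R v 2" .
  \<comment> \<open>The lower diagonal entries of the blocks are the upper ones with
    \<open>- c\<close> for \<open>c\<close>, so the previous computation is repeated at
    \<open>- c\<close>.\<close>
  have "(W 1 + W 2 - mat 1) $ 2 $ 2 = ((1 + - c) / 2) *\<^sub>R r 1 + ((1 + - c) / 2) *\<^sub>R r 2 +
      ((1 - - c) / 2) *\<^sub>R r 3 + ((1 - - c) / 2) *\<^sub>R r 4 - 1"
    by (simp add: W sum_4 rotation_rep_def rotation_projection_def scaleC_of_real mat_def)
  also have "\<dots> = - (c *\<^sub>R v 2)"
    using sum[of "1 - - c"] unfolding split(1)[of "- c"] by (simp add: v_def algebra_simps)
  finally have V22: "(W 1 + W 2 - mat 1) $ 2 $ 2 = - (c *\<^sub>R v 2)" .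
  have "(W 1 + W 2 - mat 1) $ a $ b = (s / 2) *\<^sub>R r 1 + (- s / 2) *\<^sub>R r 2 +
      (s / 2) *\<^sub>R r 3 + (- s / 2) *\<^sub>R r 4" if "a \<noteq> b" for a b
    using that by (simp add: W sum_4 rotation_rep_def rotation_projection_def scaleC_of_real mat_def)
  also have "\<dots> = s *\<^sub>R v 3"
    using sum[of s] arg_cong[OF r_sum, of "\<lambda>x. s *\<^sub>R x"] scaleR_add_right[of s 1 "1 :: 'a"]
    unfolding split(2) by (simp add: v_def scaleR_2 algebra_simps)
  finally have "(W 1 + W 2 - mat 1) $ a $ b = s *\<^sub>R v 3" if "a \<noteq> b" for a b
    using that .
  then have "(W 1 + W 2 - mat 1) $ 1 $ 2 = s *\<^sub>R v 3" "(W 1 + W 2 - mat 1) $ 2 $ 1 = s *\<^sub>R v 3"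
    by simp_all
  with coact V11 V22 show ?thesis by blast
qed

text \<open>The coaction maps \<open>v 2 ^ n\<close> to the \<open>n\<close>-th power of the rotated
  matrix, whose first column obeys the anticommuting binomial recursion. Invariance is read off at
  the entry (1, 1).\<close>

lemma haar_rotated_power:
  assumes "c\<^sup>2 + s\<^sup>2 = 1"
  shows "h (even_binomial (c *\<^sub>R v 2) (s *\<^sub>R v 3) n) = h (v 2 ^ n)"
proof -
  let ?X = "c *\<^sub>R v 2" and ?Y = "s *\<^sub>R v 3"
  obtain V where V: "coact (rotation_rep c s) (v 2) V"
    "V $ 1 $ 1 = ?X" "V $ 1 $ 2 = ?Y" "V $ 2 $ 1 = ?Y" "V $ 2 $ 2 = - ?X"
    using coact_rotation_v by blast
  have anti: "?Y * ?X = - (?X * ?Y)"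
    by (simp add: v_anticommute)
  have "\<exists>M. coact (rotation_rep c s) (v 2 ^ n) M \<and>
      M $ 1 $ 1 = even_binomial ?X ?Y n \<and> M $ 2 $ 1 = odd_binomial ?X ?Y n"
  proof (induction n)
    case 0
    show ?case
      unfolding power_0
      by (intro exI[of _ "mat 1"] conjI coact_intros)
        (simp_all add: mat_def even_binomial_def odd_binomial_def)
  next
    case (Suc n)
    then obtain M where "coact (rotation_rep c s) (v 2 ^ n) M"
      "M $ 1 $ 1 = even_binomial ?X ?Y n" "M $ 2 $ 1 = odd_binomial ?X ?Y n"
      by blast
    then show ?case
      unfolding power_Suc
      by (intro exI[of _ "V ** M"] conjI coact_intros V)
        (simp_all add: matrix_matrix_mult_def sum_2 V anticommuting_binomial_Suc[OF anti])
  qed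
  then obtain M where "coact (rotation_rep c s) (v 2 ^ n) M" "M $ 1 $ 1 = even_binomial ?X ?Y n"
    by blast
  then show ?thesis
    using haar_coact[OF rotation_rep_magic_relations[OF assms], of "v 2 ^ n" M 1 1] by simp
qed

text \<open>Rotating by the angle with tangent \<open>s\<close> does not change the moments of \<open>v 2\<close>; the recursion is
  the coefficient of \<open>s\<^sup>2\<close>.\<close>

lemma haar_mixed_moment:
  "of_nat (2 * n + 1) * h (v 2 ^ (2 * n) * v 3 ^ 2) = h (v 2 ^ (2 * Suc n))"
proof -
  define N where "N = 2 * Suc n"
  define H where "H j = (if even j then of_nat (N choose j) * h (v 2 ^ (N - j) * v 3 ^ j) else 0)" for j
  have "(\<Sum>j\<le>N. H j * of_real s ^ j) = h (v 2 ^ N) * (1 + (of_real s)\<^sup>2) ^ Suc n" for s :: real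
  proof -
    \<comment> \<open>The cosine of the angle with tangent \<open>s\<close>. The sine is
      \<open>c * s\<close>, so \<open>c ^ N\<close> factors out of every term, and its inverse is
      \<open>(1 + s\<^sup>2) ^ Suc n\<close>.\<close>
    define c where "c = 1 / sqrt (1 + s\<^sup>2)"
    have pos: "1 + s\<^sup>2 > 0"
      by (simp add: add_pos_nonneg)
    have c2: "c\<^sup>2 * (1 + s\<^sup>2) = 1"
      using pos by (simp add: c_def power_divide)
    have c: "c \<noteq> 0" "c\<^sup>2 + (c * s)\<^sup>2 = 1"
      using c2 by (auto simp: algebra_simps power_mult_distrib)
    have "h (of_nat k * a) = of_nat k * h a" for k a
      by (metis haar_scaleR of_real_of_nat_eq scaleR_conv_of_real)
    then have "h (even_binomial (c *\<^sub>R v 2) ((c * s) *\<^sub>R v 3) N) =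
        (\<Sum>j\<le>N. of_real (c ^ N) * (H j * of_real s ^ j))"
      unfolding even_binomial_def haar_sum
      by (intro sum.cong)
        (auto simp: H_def haar_0 haar_scaleR power_mult_distrib mult_ac simp flip: power_add)
    then have *: "of_real (c ^ N) * (\<Sum>j\<le>N. H j * of_real s ^ j) = h (v 2 ^ N)"
      using haar_rotated_power[OF c(2)] by (simp add: sum_distrib_left)
    have "(c ^ N) * (1 + s\<^sup>2) ^ Suc n = 1"
      unfolding N_def power_mult power_mult_distrib[symmetric] c2 by simp
    then have "of_real (c ^ N) * (1 + (of_real s)\<^sup>2) ^ Suc n = (1 :: complex)"
      by (metis of_real_1 of_real_add of_real_mult of_real_power)
    then have "of_real (c ^ N) * (\<Sum>j\<le>N. H j * of_real s ^ j) =
        of_real (c ^ N) * (h (v 2 ^ N) * (1 + (of_real s)\<^sup>2) ^ Suc n)"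
      using * by (simp add: mult_ac del: power_Suc mult_Suc_right)
    then show ?thesis
      using c(1) by (simp del: power_Suc mult_Suc_right)
  qed
  then have "H 2 = of_nat (Suc n) * h (v 2 ^ N)"
    by (rule coefficient_2_of_power_series_identity) (simp add: N_def)
  moreover have "N choose 2 = Suc n * (2 * n + 1)"
    by (simp add: N_def choose_two)
  moreover have "N - 2 = 2 * n"
    by (simp add: N_def)
  moreover have "H 2 = of_nat (N choose 2) * h (v 2 ^ (N - 2) * v 3 ^ 2)"
    by (simp add: H_def)
  ultimately have "of_nat (Suc n) * (of_nat (2 * n + 1) * h (v 2 ^ (2 * n) * v 3 ^ 2)) =
      of_nat (Suc n) * h (v 2 ^ N)"
    by (simp only: of_nat_mult mult.assoc)
  then show ?thesis
    unfolding N_def by (metis mult_left_cancel of_nat_neq_0)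
qed

text \<open>Multiply \<open>v_squares\<close> by \<open>v 2 ^ (2 * n)\<close> and apply
  \<open>h\<close>. The terms with \<open>v 3\<close> and \<open>v 4\<close> have equal value, given
  by \<open>haar_mixed_moment\<close>, so each even moment is (2n + 1) / (2n + 3) times its
  predecessor.\<close>

lemma haar_v_even_power: "h (v 2 ^ (2 * n)) = 1 / of_nat (2 * n + 1)"
proof (induction n)
  case (Suc n)
  let ?m = "h (v 2 ^ (2 * n) * v 3 ^ 2)"
  have "v 2 ^ (2 * n) = v 2 ^ (2 * n) * (v 2 * v 2 + v 3 * v 3 + v 4 * v 4)"
    by (simp add: v_squares)
  also have "\<dots> = v 2 ^ (2 * Suc n) + v 2 ^ (2 * n) * v 3 ^ 2 + v 2 ^ (2 * n) * v 4 ^ 2"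
    by (simp only: distrib_left power2_eq_square[symmetric] power_add[symmetric] mult_Suc_right
        add.commute[of 2 "2 * n"])
  finally have eq: "v 2 ^ (2 * n) = v 2 ^ (2 * Suc n) + v 2 ^ (2 * n) * v 3 ^ 2 + v 2 ^ (2 * n) * v 4 ^ 2" .
  have "h (v 2 ^ (2 * n)) = h (v 2 ^ (2 * Suc n)) + 2 * ?m"
    using arg_cong[OF eq, of h] by (simp only: haar_add haar_swap(1) mult_2 add.assoc)
  moreover define x :: complex where "x = of_nat (2 * n + 1)"
  ultimately have "1 / x = x * ?m + 2 * ?m"
    unfolding Suc.IH haar_mixed_moment[symmetric] by simp
  moreover have "x \<noteq> 0"
    unfolding x_def of_nat_eq_0_iff by simp
  ultimately have "(x * ?m) * (x + 2) = 1"
    by (simp add: field_simps)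
  moreover have x2: "x + 2 = of_nat (2 * Suc n + 1)"
    by (simp add: x_def)
  then have "x + 2 \<noteq> 0"
    by (simp only: of_nat_eq_0_iff)
  ultimately have "x * ?m = 1 / (x + 2)"
    by (metis nonzero_eq_divide_eq)
  then show ?case
    unfolding x2 haar_mixed_moment[symmetric] by (simp only: x_def)
qed (simp add: haar_one)

section \<open>Moments of the combination of two diagonal entries\<close>

text \<open>The four entries of row \<open>i\<close> contribute equally by column symmetry, and they
  sum to 1.\<close>

lemma haar_v_entry: "h (v 2 ^ (2 * n) * u $ i $ j) = 1 / (4 * of_nat (2 * n + 1))"
proof -
  let ?a = "\<lambda>j. h (v 2 ^ (2 * n) * u $ i $ j)"
  have eq: "?a 2 = ?a 1" "?a 3 = ?a 1" "?a 4 = ?a 1"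
    by (simp_all add: haar_swap)
  have "h (v 2 ^ (2 * n) * (u $ i $ 1 + u $ i $ 2 + u $ i $ 3 + u $ i $ 4)) = ?a 1 + ?a 2 + ?a 3 + ?a 4"
    by (simp add: distrib_left haar_add)
  then have "1 / of_nat (2 * n + 1) = 4 * ?a 1"
    unfolding u_simps eq mult_1_right haar_v_even_power by simp
  then have "?a 1 = (1 / of_nat (2 * n + 1)) / 4"
    by simp
  then have "?a 1 = 1 / (4 * of_nat (2 * n + 1))"
    by (simp only: divide_divide_eq_left mult.commute)
  moreover have "?a j = ?a 1"
    using exhaust_4[of j] eq by auto
  ultimately show ?thesis by simp
qed

text \<open>Expand the last factor \<open>v 2\<close> of \<open>v 2 ^ (2 * Suc n)\<close>. The
  constant -1 meets a vanishing odd moment, and exchanging columns 1 and 2 pairs the four entries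
  into twice the diagonal ones.\<close>

lemma haar_v_odd_entry:
  "h (v 2 ^ (2 * n + 1) * (u $ 1 $ 1 + u $ 2 $ 2)) = 1 / (2 * of_nat (2 * n + 3))"
proof -
  let ?x = "v 2 ^ (2 * n + 1)"
  have "h ?x = 0"
    using haar_swap(5)[of "2 * n + 1"] by simp
  moreover have "v 2 ^ (2 * Suc n) = ?x * v 2"
    by (simp add: power_commutes mult.assoc)
  moreover have "\<dots> = ?x * u $ 1 $ 1 + ?x * u $ 2 $ 1 + (?x * u $ 1 $ 2 + ?x * u $ 2 $ 2) - ?x"
    by (simp add: v_def r_def distrib_left right_diff_distrib)
  ultimately have "h (v 2 ^ (2 * Suc n)) = 2 * (h (?x * u $ 1 $ 1) + h (?x * u $ 2 $ 2))"
    using haar_swap(2)[of "2 * n + 1"] by (simp only: haar_add haar_diff) simp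
  then have "h (?x * (u $ 1 $ 1 + u $ 2 $ 2)) = h (v 2 ^ (2 * Suc n)) / 2"
    by (simp only: distrib_left haar_add) simp
  also have "\<dots> = 1 / (2 * of_nat (2 * Suc n + 1))"
    unfolding haar_v_even_power by (simp only: divide_divide_eq_left mult.commute)
  finally show ?thesis
    by simp
qed

text \<open>The cubic relation for \<open>w\<close> gives a recursion in \<open>k\<close> that also
  raises \<open>m\<close>, so all mixed moments are treated together. \<open>J\<close> stands for
  any solution with the right initial values; it will be instantiated by
  \<open>spectral_moment t\<close>.\<close>

lemma haar_moments:
  fixes t :: real and J :: "nat \<Rightarrow> nat \<Rightarrow> real"
  defines "w \<equiv> ((1 + t) / 2) *\<^sub>R u $ 1 $ 1 + ((1 - t) / 2) *\<^sub>R u $ 2 $ 2"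
    and "\<tau> \<equiv> (1 - t\<^sup>2) / 4"
  assumes J1: "\<And>m. J m 1 = 1 / (4 * of_nat (2 * m + 1))"
    and J2: "\<And>m. J m 2 = ((1 - 2 * \<tau>) / of_nat (2 * m + 1) + 2 * \<tau> / of_nat (2 * m + 3)) / 4"
    and J: "\<And>m k. k \<ge> 1 \<Longrightarrow> J m (k + 2) = J m (k + 1) - \<tau> * (J m k - J (Suc m) k)"
    and "k \<ge> 1"
  shows "h (v 2 ^ (2 * m) * w ^ k) = of_real (J m k)"
proof -
  let ?p = "u $ 1 $ 1" and ?q = "u $ 2 $ 2"
  \<comment> \<open>The two weights are the roots of x^2 - x + \<tau>.\<close>
  define \<alpha> \<beta> where "\<alpha> = (1 + t) / 2" and "\<beta> = (1 - t) / 2"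
  have ab: "\<alpha> * \<alpha> = \<alpha> - \<tau>" "\<beta> * \<beta> = \<beta> - \<tau>" "\<alpha> * \<beta> = \<tau>" "\<beta> * \<alpha> = \<tau>"
    by (simp_all add: \<alpha>_def \<beta>_def \<tau>_def field_simps power2_eq_square)
  have w: "w = \<alpha> *\<^sub>R ?p + \<beta> *\<^sub>R ?q"
    by (simp add: w_def \<alpha>_def \<beta>_def)
  have w2: "w * w = w - \<tau> *\<^sub>R (?p + ?q - v 2 * (?p + ?q))"
    by (simp add: w algebra_simps u_simps v_mult ab)
  have pqp: "?p * ?q * ?p = v 2 ^ 2 * ?p" "?q * ?p * ?q = v 2 ^ 2 * ?q"
    by (simp_all add: power2_eq_square mult.assoc v_mult) (simp_all add: v_mult flip: mult.assoc)
  have "(?p + ?q - v 2 * (?p + ?q)) * w = w - v 2 ^ 2 * w"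
    using pqp by (simp add: w algebra_simps u_simps v_mult)
  moreover have "w * w * w = (w - \<tau> *\<^sub>R (?p + ?q - v 2 * (?p + ?q))) * w"
    by (simp only: w2)
  ultimately have w3: "w * w * w = w * w - \<tau> *\<^sub>R (w - v 2 ^ 2 * w)"
    by (simp only: left_diff_distrib mult_scaleR_left)
  show ?thesis
    using \<open>k \<ge> 1\<close>
  proof (induction k arbitrary: m rule: less_induct)
    case (less k)
    \<comment> \<open>The cubic relation has no constant term and rewrites \<open>w ^ k\<close> only
      from the third power on, so the first two powers are initial values.\<close>
    consider "k = 1" | "k = 2" | l where "k = Suc l + 2"
      using less.prems by (metis One_nat_def Suc_1 add_2_eq_Suc' not0_implies_Suc not_one_le_zero)
    then show ?case
    proof cases
      case 1
      have "h (v 2 ^ (2 * m) * w) = (of_real \<alpha> + of_real \<beta>) / (4 * of_nat (2 * m + 1))"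
        unfolding w distrib_left haar_add mult_scaleR_right haar_scaleR haar_v_entry
        by (simp add: add_divide_distrib)
      also have "of_real \<alpha> + of_real \<beta> = (1 :: complex)"
        by (simp add: \<alpha>_def \<beta>_def field_simps)
      finally show ?thesis
        using 1 by (simp add: J1[simplified])
    next
      case 2
      have "v 2 ^ (2 * m) * (w * w) = v 2 ^ (2 * m) * w - \<tau> *\<^sub>R
          (v 2 ^ (2 * m) * ?p + v 2 ^ (2 * m) * ?q - v 2 ^ (2 * m + 1) * (?p + ?q))"
        unfolding w2 power_add power_one_right by (simp add: algebra_simps)
      then have "h (v 2 ^ (2 * m) * (w * w)) = h (v 2 ^ (2 * m) * w) - of_real \<tau> *
          (h (v 2 ^ (2 * m) * ?p) + h (v 2 ^ (2 * m) * ?q) - h (v 2 ^ (2 * m + 1) * (?p + ?q)))"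
        by (simp only: haar_add haar_diff haar_scaleR)
      also have "h (v 2 ^ (2 * m) * w) = of_real (J m 1)"
        using less.IH[of 1] 2 by simp
      finally have "h (v 2 ^ (2 * m) * w ^ k) = 1 / (4 * of_nat (2 * m + 1)) - of_real \<tau> *
          (1 / (4 * of_nat (2 * m + 1)) + 1 / (4 * of_nat (2 * m + 1)) - 1 / (2 * of_nat (2 * m + 3)))"
        unfolding 2 J1 haar_v_entry haar_v_odd_entry power2_eq_square by simp
      moreover have id: "1 / (4 * a) - c * (1 / (4 * a) + 1 / (4 * a) - 1 / (2 * b)) =
          ((1 - 2 * c) / a + 2 * c / b) / 4" if "a \<noteq> 0" "b \<noteq> 0" for a b c :: complex
        using that by (simp add: field_simps)
      moreover have "of_nat (2 * m + 1) \<noteq> (0 :: complex)" "of_nat (2 * m + 3) \<noteq> (0 :: complex)"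
        unfolding of_nat_eq_0_iff by simp_all
      moreover have "of_real (J m 2) = ((1 - 2 * of_real \<tau>) / of_nat (2 * m + 1) +
          2 * of_real \<tau> / of_nat (2 * m + 3)) / (4 :: complex)"
        by (simp add: J2)
      ultimately show ?thesis
        by (simp only: 2 id)
    next
      case 3
      have "v 2 ^ (2 * m) * w ^ k = v 2 ^ (2 * m) * (w * w * w) * w ^ l"
        by (simp add: 3 power_commutes mult.assoc flip: power_Suc)
      also have "\<dots> = v 2 ^ (2 * m) * (w * w * w ^ l) - \<tau> *\<^sub>R
          (v 2 ^ (2 * m) * (w * w ^ l) - (v 2 ^ (2 * m) * v 2 ^ 2) * (w * w ^ l))"
        unfolding w3 by (simp only: right_diff_distrib left_diff_distrib mult_scaleR_left
            mult_scaleR_right mult.assoc)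
      also have "v 2 ^ (2 * m) * v 2 ^ 2 = v 2 ^ (2 * Suc m)"
        by (simp only: power_add[symmetric] mult_Suc_right add.commute)
      also have "w * w ^ l = w ^ Suc l"
        by simp
      also have "w * w * w ^ l = w ^ (Suc l + 1)"
        by (simp add: mult.assoc)
      finally have "h (v 2 ^ (2 * m) * w ^ k) = of_real (J m (Suc l + 1)) - of_real \<tau> * (of_real (J m (Suc l)) - of_real (J (Suc m) (Suc l)))"
        using less.IH[of "Suc l + 1" m] less.IH[of "Suc l"] 3 by (simp only: haar_diff haar_scaleR)
      then show ?thesis
        using J[of "Suc l" m] 3 by simp
    qed
  qed
qed

end

section \<open>Geometric series of moments\<close>

text \<open>Termwise integration of the geometric series, dominated by the powers of
  \<open>cmod X * B\<close>. It recovers resolvent integrals from moments, both for the law and for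
  the explicit spectral integrals.\<close>

lemma geometric_moments_sums:
  fixes Y :: "'a \<Rightarrow> real" and X :: complex
  assumes "finite_measure M" and [measurable]: "Y \<in> borel_measurable M"
    and B: "AE y in M. \<bar>Y y\<bar> \<le> B" and X: "cmod X * B < 1" "0 \<le> B"
  shows "(\<lambda>n. X ^ n * of_real (\<integral>y. Y y ^ n \<partial>M)) sums (\<integral>y. 1 / (1 - X * of_real (Y y)) \<partial>M)"
    and "integrable M (\<lambda>y. 1 / (1 - X * of_real (Y y)))"
proof -
  interpret finite_measure M by fact
  define f where "f n y = (X * of_real (Y y)) ^ n" for n y
  have [measurable]: "f n \<in> borel_measurable M" for n
    unfolding f_def by measurable
  have bound: "norm (X * of_real (Y y)) \<le> cmod X * B" if "\<bar>Y y\<bar> \<le> B" for y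
    using that by (simp add: norm_mult mult_left_mono)
  then have bound_f: "AE y in M. norm (f n y) \<le> (cmod X * B) ^ n" for n
    using B unfolding f_def norm_power by (auto intro!: power_mono elim: AE_mp)
  have int: "integrable M (f n)" for n
    by (rule integrable_const_bound[OF bound_f]) simp
  have summable: "AE y in M. summable (\<lambda>n. norm (f n y))"
    using B
  proof eventually_elim
    case (elim y)
    show ?case
      unfolding f_def norm_power by (intro summable_geometric) (use bound[of y] X elim in simp)
  qed
  have "norm (\<integral>y. norm (f n y) \<partial>M) \<le> (cmod X * B) ^ n * measure M (space M)" for n
  proof -
    have "(\<integral>y. norm (f n y) \<partial>M) \<le> (\<integral>y. (cmod X * B) ^ n \<partial>M)"
      using bound_f int by (intro integral_mono_AE) auto
    then show ?thesis
      by (simp add: mult.commute)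
  qed
  then have summable_int: "summable (\<lambda>n. \<integral>y. norm (f n y) \<partial>M)"
    by (rule summable_comparison_test'[rotated, where N = 0])
      (use X in \<open>intro summable_mult2 summable_geometric, simp\<close>)
  have suminf: "AE y in M. suminf (\<lambda>n. f n y) = 1 / (1 - X * of_real (Y y))"
    using B
  proof eventually_elim
    case (elim y)
    then have "norm (X * of_real (Y y)) < 1"
      using bound[of y] X by simp
    then show ?case
      unfolding f_def by (rule suminf_geometric)
  qed
  have [measurable]: "(\<lambda>y. 1 / (1 - X * of_real (Y y))) \<in> borel_measurable M"
    by measurable
  have "(\<lambda>n. \<integral>y. f n y \<partial>M) sums (\<integral>y. suminf (\<lambda>n. f n y) \<partial>M)"
    by (rule sums_integral[OF int summable summable_int])
  also have "(\<integral>y. suminf (\<lambda>n. f n y) \<partial>M) = (\<integral>y. 1 / (1 - X * of_real (Y y)) \<partial>M)"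
    by (rule integral_cong_AE) (use suminf in auto)
  also have "(\<lambda>n. \<integral>y. f n y \<partial>M) = (\<lambda>n. X ^ n * of_real (\<integral>y. Y y ^ n \<partial>M))"
  proof
    fix n
    have "(\<integral>y. f n y \<partial>M) = (\<integral>y. X ^ n * of_real (Y y ^ n) \<partial>M)"
      by (simp add: f_def power_mult_distrib)
    then show "(\<integral>y. f n y \<partial>M) = X ^ n * of_real (\<integral>y. Y y ^ n \<partial>M)"
      by (simp only: integral_mult_right_zero integral_complex_of_real)
  qed
  finally show "(\<lambda>n. X ^ n * of_real (\<integral>y. Y y ^ n \<partial>M)) sums (\<integral>y. 1 / (1 - X * of_real (Y y)) \<partial>M)" .
  have "integrable M (\<lambda>y. suminf (\<lambda>n. f n y))"
    by (rule integrable_suminf[OF int summable summable_int])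
  then show "integrable M (\<lambda>y. 1 / (1 - X * of_real (Y y)))"
    by (rule integrable_cong_AE_imp) (use suminf in auto)
qed

section \<open>Integrals over the unit interval\<close>

abbreviation unit_lebesgue :: "real measure" where
  "unit_lebesgue \<equiv> restrict_space lborel {0..1}"

lemma finite_measure_unit_lebesgue: "finite_measure unit_lebesgue"
  by (rule finite_measureI) (simp add: emeasure_restrict_space space_restrict_space)

lemma integral_unit_lebesgue:
  fixes f :: "real \<Rightarrow> 'a :: {banach, second_countable_topology}"
  shows "(\<integral>y. f y \<partial>unit_lebesgue) = (\<integral>y. indicator {0..1} y *\<^sub>R f y \<partial>lborel)"
  by (rule integral_restrict_space) simp

lemma integrable_unit_lebesgue:
  fixes f :: "real \<Rightarrow> 'a :: {banach, second_countable_topology}"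
  assumes "continuous_on {0..1} f"
  shows "integrable unit_lebesgue f"
  using borel_integrable_compact[OF _ assms] by (subst integrable_restrict_space) auto

lemma integral_power_unit_lebesgue: "(\<integral>y. y ^ k \<partial>unit_lebesgue) = 1 / of_nat (Suc k)"
  using integral_power[of 0 1 k] by (simp add: integral_unit_lebesgue mult.commute)

text \<open>With b = sqrt x / 2 and B = sqrt (1 + x / 4), the denominator factors as (B + b y) (B -
  b y), which gives a logarithmic primitive. Since (B + b) (B - b) = 1, its value at 1 is ln (B + b)
  / (b B), and ln (B + b) is arsinh b.\<close>

lemma arsinh_integral:
  assumes "x > 0"
  shows "(\<integral>y. 1 / (1 + x / 4 * (1 - y\<^sup>2)) \<partial>unit_lebesgue) = 4 * arsinh (sqrt x / 2) / sqrt (4 * x + x\<^sup>2)"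
proof -
  define b B where "b = sqrt x / 2" and "B = sqrt (1 + x / 4)"
  have b: "b > 0" "b\<^sup>2 = x / 4" and B: "B\<^sup>2 = 1 + x / 4"
    using assms by (simp_all add: b_def B_def power_divide)
  have "b < B"
    by (rule power2_less_imp_less) (use assms in \<open>simp_all add: b B, simp add: B_def\<close>)
  have bB: "(B + b) * (B - b) = 1"
    using b B by (simp add: algebra_simps power2_eq_square)
  have pos: "B + b * y > 0" "B - b * y > 0" if "0 \<le> y" "y \<le> 1" for y
  proof -
    have "b * y \<le> b"
      using that b(1) by (simp add: mult_left_le)
    moreover have "0 \<le> b * y"
      using that b(1) by simp
    ultimately show "B + b * y > 0" "B - b * y > 0"
      using \<open>b < B\<close> b(1) by linarith+
  qed
  have den: "1 + x / 4 * (1 - y\<^sup>2) = (B + b * y) * (B - b * y)" for y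
  proof -
    have "(B + b * y) * (B - b * y) = B\<^sup>2 - b\<^sup>2 * y\<^sup>2"
      by (simp add: algebra_simps power2_eq_square)
    then show ?thesis
      by (simp add: b B algebra_simps)
  qed
  have "(\<integral>y. indicator {0..1} y *\<^sub>R (1 / (1 + x / 4 * (1 - y\<^sup>2))) \<partial>lborel) =
      (ln (B + b * 1) - ln (B - b * 1)) / (2 * b * B) - (ln (B + b * 0) - ln (B - b * 0)) / (2 * b * B)"
  proof (rule integral_FTC_Icc)
    fix y :: real
    assume y: "0 \<le> y" "y \<le> 1"
    have "((\<lambda>y. ln (B + b * y) - ln (B - b * y)) has_real_derivative
        b / (B + b * y) + b / (B - b * y)) (at y within {0..1})"
      using pos[OF y] by (auto intro!: derivative_eq_intros)
    then have "((\<lambda>y. (ln (B + b * y) - ln (B - b * y)) / (2 * b * B)) has_real_derivative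
        (b / (B + b * y) + b / (B - b * y)) / (2 * b * B)) (at y within {0..1})"
      by (rule DERIV_cdivide)
    also have "(b / (B + b * y) + b / (B - b * y)) / (2 * b * B) = 1 / (1 + x / 4 * (1 - y\<^sup>2))"
      unfolding den using pos[OF y] b \<open>b < B\<close> by (simp add: divide_simps) (simp add: algebra_simps)
    finally show "((\<lambda>y. (ln (B + b * y) - ln (B - b * y)) / (2 * b * B)) has_vector_derivative
        1 / (1 + x / 4 * (1 - y\<^sup>2))) (at y within {0..1})"
      by (simp add: has_real_derivative_iff_has_vector_derivative)
  next
    show "continuous_on {0..1} (\<lambda>y. 1 / (1 + x / 4 * (1 - y\<^sup>2)))"
      unfolding den using pos by (intro continuous_intros) (auto simp: less_imp_neq[symmetric])
  qed simp
  also have "ln (B - b * 1) = - ln (B + b * 1)"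
    using bB \<open>b < B\<close> b by (metis add_pos_pos diff_gt_0_iff_gt inverse_unique ln_inverse mult.right_neutral order.strict_trans)
  also have "ln (B + b * 1) = arsinh (sqrt x / 2)"
    using assms by (simp add: arsinh_real_def B_def b_def power_divide add.commute)
  also have "sqrt (4 * x + x\<^sup>2) = 4 * (b * B)"
  proof (rule real_sqrt_unique)
    have "(4 * (b * B))\<^sup>2 = 16 * (b\<^sup>2 * B\<^sup>2)"
      by (simp add: power_mult_distrib)
    then show "(4 * (b * B))\<^sup>2 = 4 * x + x\<^sup>2"
      unfolding b(2) B by (simp add: algebra_simps power2_eq_square)
    show "0 \<le> 4 * (b * B)"
      using b(1) \<open>b < B\<close> by simp
  qed
  then have "2 * b * B = sqrt (4 * x + x\<^sup>2) / 2"
    by simp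
  finally show ?thesis
    by (simp add: integral_unit_lebesgue)
qed

text \<open>The analytic continuation as an integral, which involves no branches of the square root
  or of arsinh. The denominator has the shape required by
  \<open>geometric_moments_sums\<close>.\<close>

definition arsinh_quotient :: "complex \<Rightarrow> complex" where
  "arsinh_quotient z = (\<integral>y. 1 / (1 - z * of_real (- (1 - y\<^sup>2) / 4)) \<partial>unit_lebesgue) / 4"

lemma arsinh_quotient_of_real:
  assumes "x > 0"
  shows "arsinh_quotient (of_real x) = of_real (arsinh (sqrt x / 2) / sqrt (4 * x + x\<^sup>2))"
proof -
  have "arsinh_quotient (of_real x) = (\<integral>y. of_real (1 / (1 + x / 4 * (1 - y\<^sup>2))) \<partial>unit_lebesgue) / 4"
    by (simp add: arsinh_quotient_def field_simps)
  then show ?thesis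
    unfolding integral_complex_of_real arsinh_integral[OF assms] by simp
qed

lemma holomorphic_arsinh_quotient: "arsinh_quotient holomorphic_on ball 0 1"
proof (rule power_series_holomorphic)
  fix z :: complex
  assume z: "z \<in> ball 0 1"
  let ?Y = "\<lambda>y :: real. - (1 - y\<^sup>2) / 4"
  have "\<bar>?Y y\<bar> \<le> 1" if "0 \<le> y" "y \<le> 1" for y
  proof -
    have "y\<^sup>2 \<le> 1"
      using that by (simp add: power_le_one)
    then show ?thesis
      using zero_le_power2[of y] by (auto simp: abs_le_iff field_simps simp del: zero_le_power2)
  qed
  then have "AE y in unit_lebesgue. \<bar>?Y y\<bar> \<le> 1"
    by (intro AE_I2) (auto simp: space_restrict_space)
  moreover have "?Y \<in> borel_measurable unit_lebesgue"
    by (rule measurable_restrict_space1) measurable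
  ultimately have "(\<lambda>n. z ^ n * of_real (\<integral>y. ?Y y ^ n \<partial>unit_lebesgue)) sums
      (\<integral>y. 1 / (1 - z * of_real (?Y y)) \<partial>unit_lebesgue)"
    using z by (intro geometric_moments_sums(1)[OF finite_measure_unit_lebesgue, where B = 1]) auto
  from sums_divide[OF this, of 4]
  show "(\<lambda>n. (of_real (\<integral>y. ?Y y ^ n \<partial>unit_lebesgue) / 4) * (z - 0) ^ n) sums arsinh_quotient z"
    unfolding arsinh_quotient_def by (simp only: diff_zero times_divide_eq_left times_divide_eq_right mult.commute)
qed

text \<open>The identity theorem: both functions are holomorphic near 0 and agree on positive reals
  accumulating there.\<close>

lemma analytic_eq_arsinh_quotient:
  assumes "F analytic_on {0}"
    and "\<forall>\<^sub>F x in at_right (0 :: real).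
           F (complex_of_real x) = complex_of_real (arsinh (sqrt x / 2) / sqrt (4 * x + x\<^sup>2))"
  shows "\<exists>\<epsilon>>0. \<forall>z\<in>ball 0 \<epsilon>. F z = arsinh_quotient z"
proof -
  obtain e where e: "e > 0" "F holomorphic_on ball 0 e"
    using assms(1) by (auto simp: analytic_on_def)
  obtain d where d: "d > 0" "\<And>x. 0 < x \<Longrightarrow> x < d \<Longrightarrow> F (of_real x) = arsinh_quotient (of_real x)"
    using assms(2) arsinh_quotient_of_real by (auto simp: eventually_at_right_field)
  define \<epsilon> where "\<epsilon> = min e 1"
  have "\<epsilon> > 0"
    using e by (simp add: \<epsilon>_def)
  have "F z - arsinh_quotient z = 0" if "z \<in> ball 0 \<epsilon>" for z
  proof (rule analytic_continuation[of "\<lambda>z. F z - arsinh_quotient z" "ball 0 \<epsilon>" "of_real ` {0<..<min d \<epsilon>}" 0 z])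
    show "(\<lambda>z. F z - arsinh_quotient z) holomorphic_on ball 0 \<epsilon>"
      using e holomorphic_arsinh_quotient
      by (auto simp: \<epsilon>_def intro!: holomorphic_intros elim!: holomorphic_on_subset)
    show "(0 :: complex) islimpt of_real ` {0<..<min d \<epsilon>}"
      unfolding islimpt_approachable
    proof (intro allI impI)
      fix r :: real
      assume "r > 0"
      then have "min r (min d \<epsilon>) / 2 \<in> {0<..<min d \<epsilon>}" "min r (min d \<epsilon>) / 2 < r"
        using \<open>\<epsilon> > 0\<close> d(1) by auto
      then show "\<exists>x'\<in>of_real ` {0<..<min d \<epsilon>}. x' \<noteq> 0 \<and> dist x' (0 :: complex) < r"
        using \<open>\<epsilon> > 0\<close> d(1) \<open>r > 0\<close>
        by (intro bexI[of _ "of_real (min r (min d \<epsilon>) / 2)"] imageI) (auto simp del: of_real_divide)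
    qed
  qed (use d \<open>\<epsilon> > 0\<close> that in auto)
  then show ?thesis
    using \<open>\<epsilon> > 0\<close> by auto
qed

section \<open>The spectral measure of a combination of two projections\<close>

text \<open>The eigenvalues of $\frac{1+t}{2} p + \frac{1-t}{2} q$ for two rank one projections on a
  plane with \<open>p q p = y\<^sup>2 p\<close>, for the sign \<open>\<sigma> = 1\<close> or \<open>\<sigma> = -1\<close>.\<close>

definition spectral_value :: "real \<Rightarrow> real \<Rightarrow> real \<Rightarrow> real" where
  "spectral_value \<sigma> t y = (1 + \<sigma> * sqrt (y\<^sup>2 + t\<^sup>2 - t\<^sup>2 * y\<^sup>2)) / 2"

text \<open>The radicand equals 1 - (1 - t^2) (1 - y^2), the discriminant of the quadratic equation.
  Written as y^2 + t^2 (1 - y^2), it is nonnegative for every real \<open>t\<close>, and it is at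
  most 1 + t^2.\<close>

lemma spectral_value:
  assumes "0 \<le> y" "y \<le> 1" "\<sigma>\<^sup>2 = 1"
  shows "spectral_value \<sigma> t y ^ 2 = spectral_value \<sigma> t y - (1 - t\<^sup>2) / 4 * (1 - y\<^sup>2)"
    and "\<bar>spectral_value \<sigma> t y\<bar> \<le> 1 + \<bar>t\<bar>"
proof -
  have y: "0 \<le> 1 - y\<^sup>2" "y\<^sup>2 \<le> 1"
    using assms by (simp_all add: power_le_one)
  have D: "y\<^sup>2 + t\<^sup>2 - t\<^sup>2 * y\<^sup>2 = y\<^sup>2 + t\<^sup>2 * (1 - y\<^sup>2)"
    by (simp add: algebra_simps)
  have D0: "0 \<le> y\<^sup>2 + t\<^sup>2 - t\<^sup>2 * y\<^sup>2"
    unfolding D using y(1) by (intro add_nonneg_nonneg mult_nonneg_nonneg) auto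
  then show "spectral_value \<sigma> t y ^ 2 = spectral_value \<sigma> t y - (1 - t\<^sup>2) / 4 * (1 - y\<^sup>2)"
    using assms(3) by (simp add: spectral_value_def power2_sum power_mult_distrib power_divide)
      (simp add: field_simps)
  have "0 \<le> t\<^sup>2 * y\<^sup>2"
    by simp
  then have "y\<^sup>2 + t\<^sup>2 - t\<^sup>2 * y\<^sup>2 \<le> 1 + t\<^sup>2"
    using y(2) by linarith
  also have "\<dots> \<le> (1 + \<bar>t\<bar>)\<^sup>2"
    by (simp add: power2_sum)
  finally have "y\<^sup>2 + t\<^sup>2 - t\<^sup>2 * y\<^sup>2 \<le> (1 + \<bar>t\<bar>)\<^sup>2" .
  then have "sqrt (y\<^sup>2 + t\<^sup>2 - t\<^sup>2 * y\<^sup>2) \<le> 1 + \<bar>t\<bar>"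
    by (intro real_le_lsqrt) auto
  moreover have "\<bar>\<sigma>\<bar> = 1"
    using assms(3) by (auto simp: power2_eq_1_iff)
  ultimately show "\<bar>spectral_value \<sigma> t y\<bar> \<le> 1 + \<bar>t\<bar>"
    using D0 abs_triangle_ineq[of 1 "\<sigma> * sqrt (y\<^sup>2 + t\<^sup>2 - t\<^sup>2 * y\<^sup>2)"]
    by (simp add: spectral_value_def abs_mult)
qed

lemma measurable_spectral_value: "spectral_value \<sigma> t \<in> borel_measurable unit_lebesgue"
  unfolding spectral_value_def[abs_def] by (rule measurable_restrict_space1) measurable

lemma AE_spectral_value:
  assumes "\<sigma>\<^sup>2 = 1"
  shows "AE y in unit_lebesgue. \<bar>spectral_value \<sigma> t y\<bar> \<le> 1 + \<bar>t\<bar>"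
  using assms by (intro AE_I2 spectral_value) (auto simp: space_restrict_space)

text \<open>The solution \<open>J\<close> for \<open>haar_moments\<close>: \<open>y\<close> models
  \<open>v 2\<close>, and each sign has weight 1/4, the remaining mass 1/2 being the atom at
  0.\<close>

definition spectral_moment :: "real \<Rightarrow> nat \<Rightarrow> nat \<Rightarrow> real" where
  "spectral_moment t m k =
     (\<integral>y. y ^ (2 * m) * (spectral_value 1 t y ^ k + spectral_value (-1) t y ^ k) \<partial>unit_lebesgue) / 4"

lemma continuous_spectral_value [continuous_intros]:
  "continuous_on S (\<lambda>y. spectral_value \<sigma> t y)"
  unfolding spectral_value_def by (intro continuous_intros) auto

lemma spectral_moment_cong:
  assumes "\<And>y. 0 \<le> y \<Longrightarrow> y \<le> 1 \<Longrightarrow> spectral_value 1 t y ^ k + spectral_value (-1) t y ^ k = f y"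
  shows "spectral_moment t m k = (\<integral>y. y ^ (2 * m) * f y \<partial>unit_lebesgue) / 4"
  unfolding spectral_moment_def
  by (intro arg_cong2[of _ _ _ _ "(/)"] refl Bochner_Integration.integral_cong) (auto simp: space_restrict_space assms)

lemma spectral_moment_1: "spectral_moment t m 1 = 1 / (4 * of_nat (2 * m + 1))"
proof -
  have "spectral_moment t m 1 = (\<integral>y. y ^ (2 * m) * 1 \<partial>unit_lebesgue) / 4"
    by (rule spectral_moment_cong) (simp add: spectral_value_def field_simps)
  then show ?thesis
    by (simp add: integral_power_unit_lebesgue)
qed

lemma spectral_moment_2:
  fixes t defines "\<tau> \<equiv> (1 - t\<^sup>2) / 4"
  shows "spectral_moment t m 2 = ((1 - 2 * \<tau>) / of_nat (2 * m + 1) + 2 * \<tau> / of_nat (2 * m + 3)) / 4"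
proof -
  have "spectral_moment t m 2 = (\<integral>y. y ^ (2 * m) * ((1 - 2 * \<tau>) + 2 * \<tau> * y\<^sup>2) \<partial>unit_lebesgue) / 4"
  proof (rule spectral_moment_cong)
    fix y :: real
    assume y: "0 \<le> y" "y \<le> 1"
    have "spectral_value 1 t y + spectral_value (-1) t y = 1"
      by (simp add: spectral_value_def field_simps)
    then show "spectral_value 1 t y ^ 2 + spectral_value (-1) t y ^ 2 = (1 - 2 * \<tau>) + 2 * \<tau> * y\<^sup>2"
      unfolding \<tau>_def using y by (simp add: spectral_value(1)) (simp add: field_simps)
  qed
  also have "(\<integral>y. y ^ (2 * m) * ((1 - 2 * \<tau>) + 2 * \<tau> * y\<^sup>2) \<partial>unit_lebesgue) =
      (\<integral>y. (1 - 2 * \<tau>) * y ^ (2 * m) + 2 * \<tau> * y ^ (2 * m + 2) \<partial>unit_lebesgue)"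
    by (simp add: algebra_simps power_add power2_eq_square)
  also have "\<dots> = (1 - 2 * \<tau>) * (\<integral>y. y ^ (2 * m) \<partial>unit_lebesgue) + 2 * \<tau> * (\<integral>y. y ^ (2 * m + 2) \<partial>unit_lebesgue)"
    by (subst Bochner_Integration.integral_add)
      (auto intro!: integrable_unit_lebesgue continuous_intros simp del: power_Suc)
  also have "\<dots> = (1 - 2 * \<tau>) / of_nat (2 * m + 1) + 2 * \<tau> / of_nat (2 * m + 3)"
    unfolding integral_power_unit_lebesgue by (simp add: numeral_3_eq_3)
  finally show ?thesis .
qed

text \<open>The quadratic equation of the eigenvalues, multiplied by their \<open>k\<close>-th
  powers and integrated; its factor \<open>y\<^sup>2\<close> raises \<open>m\<close> by one.\<close>

lemma spectral_moment_rec: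
  fixes t defines "\<tau> \<equiv> (1 - t\<^sup>2) / 4"
  shows "spectral_moment t m (k + 2) =
    spectral_moment t m (k + 1) - \<tau> * (spectral_moment t m k - spectral_moment t (Suc m) k)"
proof -
  let ?s = "\<lambda>k y. spectral_value 1 t y ^ k + spectral_value (-1) t y ^ k"
  let ?I = "\<lambda>m k. \<integral>y. y ^ (2 * m) * ?s k y \<partial>unit_lebesgue"
  have int: "integrable unit_lebesgue (\<lambda>y. y ^ (2 * m) * ?s k y)" for m k
    by (intro integrable_unit_lebesgue continuous_intros)
  have "spectral_moment t m (k + 2) = (\<integral>y. y ^ (2 * m) * (?s (k + 1) y - \<tau> * (1 - y\<^sup>2) * ?s k y) \<partial>unit_lebesgue) / 4"
  proof (rule spectral_moment_cong)
    fix y :: real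
    assume y: "0 \<le> y" "y \<le> 1"
    show "?s (k + 2) y = ?s (k + 1) y - \<tau> * (1 - y\<^sup>2) * ?s k y"
      unfolding power_add[of _ k 2] spectral_value(1)[OF y, of 1 t, OF one_power2, folded \<tau>_def]
        spectral_value(1)[OF y, of "-1" t, OF power2_minus[of 1, unfolded one_power2], folded \<tau>_def]
      by (simp add: algebra_simps)
  qed
  also have "(\<integral>y. y ^ (2 * m) * (?s (k + 1) y - \<tau> * (1 - y\<^sup>2) * ?s k y) \<partial>unit_lebesgue) =
      (\<integral>y. y ^ (2 * m) * ?s (k + 1) y - \<tau> * (y ^ (2 * m) * ?s k y - y ^ (2 * Suc m) * ?s k y) \<partial>unit_lebesgue)"
    by (intro Bochner_Integration.integral_cong refl) (simp add: algebra_simps power2_eq_square)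
  also have "\<dots> = ?I m (k + 1) - \<tau> * (?I m k - ?I (Suc m) k)"
    using int[of m "k + 1"] int[of m k] int[of "Suc m" k]
    by (simp only: Bochner_Integration.integral_diff integral_mult_right_zero
        Bochner_Integration.integrable_diff integrable_mult_right)
  finally show ?thesis
    by (simp add: spectral_moment_def field_simps del: mult_Suc_right power_Suc)
qed

text \<open>The eigenvalues e and 1 - e give two reciprocals with sum (2 - X) / ((1 - X e) (1 - X (1
  - e))). Factoring 1 - X out of the denominator leaves the integrand of
  \<open>arsinh_quotient\<close>.\<close>

lemma integral_spectral_value_pair:
  assumes "cmod X * (1 + \<bar>t\<bar>) < 1" "X \<noteq> 0" "X \<noteq> 1"
  shows "(\<integral>y. 1 / (1 - X * of_real (spectral_value 1 t y)) \<partial>unit_lebesgue) +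
      (\<integral>y. 1 / (1 - X * of_real (spectral_value (-1) t y)) \<partial>unit_lebesgue) =
    4 * ((2 - X) / (1 - X) * arsinh_quotient ((1 - (of_real t)\<^sup>2) * X\<^sup>2 / (1 - X)))"
proof -
  let ?e = "\<lambda>\<sigma> y. complex_of_real (spectral_value \<sigma> t y)"
  have int: "integrable unit_lebesgue (\<lambda>y. 1 / (1 - X * ?e \<sigma> y))" if "\<sigma>\<^sup>2 = 1" for \<sigma>
    by (rule geometric_moments_sums(2)[OF finite_measure_unit_lebesgue measurable_spectral_value
          AE_spectral_value[OF that] assms(1)]) simp
  have nz: "1 - X * ?e \<sigma> y \<noteq> 0" if "0 \<le> y" "y \<le> 1" "\<sigma>\<^sup>2 = 1" for \<sigma> y
  proof
    assume "1 - X * ?e \<sigma> y = 0"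
    then have "cmod (X * ?e \<sigma> y) = 1"
      by simp
    moreover have "cmod (X * ?e \<sigma> y) \<le> cmod X * (1 + \<bar>t\<bar>)"
      using spectral_value(2)[OF that, of t] by (simp add: norm_mult mult_left_mono)
    ultimately show False
      using assms(1) by simp
  qed
  have "1 / (1 - X * ?e 1 y) + 1 / (1 - X * ?e (-1) y) =
      (2 - X) / (1 - X) * (1 / (1 - (1 - (of_real t)\<^sup>2) * X\<^sup>2 / (1 - X) * of_real (- (1 - y\<^sup>2) / 4)))"
    if "0 \<le> y" "y \<le> 1" for y
  proof -
    have sum: "?e (-1) y = 1 - ?e 1 y"
      by (simp add: spectral_value_def field_simps)
    define q where "q = (1 - (complex_of_real t)\<^sup>2) * of_real (- (1 - y\<^sup>2) / 4)"
    have e: "?e 1 y ^ 2 = ?e 1 y + q"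
      using arg_cong[OF spectral_value(1)[OF that, of 1 t], of complex_of_real]
      by (simp add: q_def) (simp add: algebra_simps)
    have "(1 - X * ?e 1 y) * (1 - X * ?e (-1) y) = 1 - X - X\<^sup>2 * (?e 1 y ^ 2 - ?e 1 y)"
      unfolding sum by (simp add: algebra_simps power2_eq_square)
    also have "\<dots> = (1 - X) * (1 - X\<^sup>2 / (1 - X) * q)"
      unfolding e using assms(3) by (simp add: field_simps)
    also have "X\<^sup>2 / (1 - X) * q = (1 - (of_real t)\<^sup>2) * X\<^sup>2 / (1 - X) * of_real (- (1 - y\<^sup>2) / 4)"
      by (simp add: q_def)
    finally have prod: "(1 - X * ?e 1 y) * (1 - X * ?e (-1) y) =
        (1 - X) * (1 - (1 - (of_real t)\<^sup>2) * X\<^sup>2 / (1 - X) * of_real (- (1 - y\<^sup>2) / 4))" .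
    have "1 / (1 - X * ?e 1 y) + 1 / (1 - X * ?e (-1) y) =
        (2 - X) / ((1 - X * ?e 1 y) * (1 - X * ?e (-1) y))"
      using nz[OF that, of 1] nz[OF that, of "-1"] sum by (simp add: add_frac_eq) (simp add: algebra_simps)
    then show ?thesis
      unfolding prod by simp
  qed
  then have "(\<integral>y. 1 / (1 - X * ?e 1 y) + 1 / (1 - X * ?e (-1) y) \<partial>unit_lebesgue) =
      (\<integral>y. (2 - X) / (1 - X) * (1 / (1 - (1 - (of_real t)\<^sup>2) * X\<^sup>2 / (1 - X) * of_real (- (1 - y\<^sup>2) / 4))) \<partial>unit_lebesgue)"
    by (intro Bochner_Integration.integral_cong refl) (auto simp: space_restrict_space)
  also have "\<dots> = 4 * ((2 - X) / (1 - X) * arsinh_quotient ((1 - (of_real t)\<^sup>2) * X\<^sup>2 / (1 - X)))"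
  proof -
    have "c * I = 4 * (c * (I / 4))" for c I :: complex
      by simp
    then show ?thesis
      unfolding integral_mult_right_zero arsinh_quotient_def .
  qed
  finally show ?thesis
    using int[of 1] int[of "-1"] by (simp add: Bochner_Integration.integral_add)
qed

section \<open>From moments to the Cauchy transform\<close>

text \<open>The atom at 0 contributes only to the total mass, where it supplies the half missing
  from the two spectral integrals. All other moments come from \<open>haar_moments\<close> with m =
  0.\<close>

lemma (in quantum_permutation_haar_4) law_moments:
  assumes "is_law h (((1 + t) / 2) *\<^sub>R u $ 1 $ 1 + ((1 - t) / 2) *\<^sub>R u $ 2 $ 2) \<mu>"
  shows "(\<integral>y. y ^ k \<partial>\<mu>) = (if k = 0 then 1 / 2 else 0) +
    ((\<integral>y. spectral_value 1 t y ^ k \<partial>unit_lebesgue) + (\<integral>y. spectral_value (-1) t y ^ k \<partial>unit_lebesgue)) / 4"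
proof (cases "k = 0")
  case True
  have "prob_space \<mu>"
    using assms by (simp add: is_law_def)
  then show ?thesis
    using True integral_power_unit_lebesgue[of 0] by (simp add: prob_space.prob_space)
next
  case False
  let ?w = "((1 + t) / 2) *\<^sub>R u $ 1 $ 1 + ((1 - t) / 2) *\<^sub>R u $ 2 $ 2"
  have "h (v 2 ^ (2 * 0) * ?w ^ k) = of_real (spectral_moment t 0 k)"
    by (rule haar_moments[OF spectral_moment_1 spectral_moment_2 spectral_moment_rec]) (use False in simp)
  then have "complex_of_real (\<integral>y. y ^ k \<partial>\<mu>) = of_real (spectral_moment t 0 k)"
    using assms by (simp add: is_law_def)
  then have "(\<integral>y. y ^ k \<partial>\<mu>) = spectral_moment t 0 k"
    by (simp only: of_real_eq_iff)
  also have "\<dots> = ((\<integral>y. spectral_value 1 t y ^ k \<partial>unit_lebesgue) +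
      (\<integral>y. spectral_value (-1) t y ^ k \<partial>unit_lebesgue)) / 4"
    unfolding spectral_moment_def
    by (subst Bochner_Integration.integral_add[symmetric])
      (auto intro!: integrable_unit_lebesgue continuous_intros)
  finally show ?thesis
    using False by simp
qed

theorem theorem7p1:
  fixes u :: "'a :: cstar_algebra ^ 4 ^ 4"
    and T :: "'a \<Rightarrow> 'a \<Rightarrow> 'b :: cstar_algebra"
    and \<Delta> :: "'a \<Rightarrow> 'b"
    and h :: "'a \<Rightarrow> complex"
    and t :: real
    and \<mu> :: "real measure"
    and F :: "complex \<Rightarrow> complex"
  assumes "is_A_s u"
    and "cstar_tensor_product T"
    and "comultiplication u T \<Delta>"
    and "haar_functional T \<Delta> h"
    and "is_law h (((1 + t) / 2) *\<^sub>R u $ 1 $ 1 + ((1 - t) / 2) *\<^sub>R u $ 2 $ 2) \<mu>"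
    and "F analytic_on {0}"
    and "\<forall>\<^sub>F x in at_right (0 :: real).
           F (complex_of_real x) = complex_of_real (arsinh (sqrt x / 2) / sqrt (4 * x + x\<^sup>2))"
  shows "\<forall>\<^sub>F \<xi> in at_infinity.
           cauchy_transform \<mu> \<xi> =
             1 / (2 * \<xi>) + (1 - 2 * \<xi>) / (\<xi> - \<xi>\<^sup>2) *
               F ((1 - (complex_of_real t)\<^sup>2) / (\<xi>\<^sup>2 - \<xi>))"
proof -
  interpret quantum_permutation_haar_4 u T \<Delta> h
    using assms(1-4) by unfold_locales
  obtain \<epsilon> where \<epsilon>: "\<epsilon> > 0" "\<And>z. z \<in> ball 0 \<epsilon> \<Longrightarrow> F z = arsinh_quotient z"
    using analytic_eq_arsinh_quotient[OF assms(6,7)] by blast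
  have \<mu>: "prob_space \<mu>" "sets \<mu> = sets borel" "compactly_supported \<mu>"
    using assms(5) by (auto simp: is_law_def)
  interpret \<mu>: prob_space \<mu> by fact
  obtain K where K: "compact K" "AE y in \<mu>. y \<in> K"
    using \<mu>(3) unfolding compactly_supported_def by blast
  then obtain B where B: "B > 0" "\<And>y. y \<in> K \<Longrightarrow> \<bar>y\<bar> \<le> B"
    using compact_imp_bounded[of K] by (auto simp: bounded_pos)
  have AE_B: "AE y in \<mu>. \<bar>y\<bar> \<le> B"
    using K(2) B(2) by auto
  define C where "C = cmod (1 - (of_real t)\<^sup>2)"
  \<comment> \<open>The threshold puts \<xi> outside the bounds on the support of the law and on the
    spectral values, and makes the argument of \<open>F\<close> smaller than \<epsilon>.\<close>
  have "cauchy_transform \<mu> \<xi> = 1 / (2 * \<xi>) + (1 - 2 * \<xi>) / (\<xi> - \<xi>\<^sup>2) *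
      F ((1 - (complex_of_real t)\<^sup>2) / (\<xi>\<^sup>2 - \<xi>))"
    if \<xi>: "B + \<bar>t\<bar> + C / \<epsilon> + 2 \<le> cmod \<xi>" for \<xi>
  proof -
    define X where "X = 1 / \<xi>"
    have "0 \<le> C / \<epsilon>"
      using \<epsilon>(1) by (simp add: C_def)
    then have large: "cmod \<xi> \<ge> 2" "cmod \<xi> > B" "cmod \<xi> > 1 + \<bar>t\<bar>" "cmod \<xi> > C / \<epsilon>"
      using \<xi> B(1) by linarith+
    then have nz: "\<xi> \<noteq> 0" "\<xi> \<noteq> 1" "X \<noteq> 0" "X \<noteq> 1"
      by (auto simp: X_def)
    have X: "cmod X * B < 1" "cmod X * (1 + \<bar>t\<bar>) < 1"
      using large nz by (simp_all add: X_def norm_divide field_simps)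
    have sums_e: "(\<lambda>n. X ^ n * of_real (\<integral>y. spectral_value \<sigma> t y ^ n \<partial>unit_lebesgue)) sums
        (\<integral>y. 1 / (1 - X * of_real (spectral_value \<sigma> t y)) \<partial>unit_lebesgue)" if "\<sigma>\<^sup>2 = 1" for \<sigma>
      by (rule geometric_moments_sums(1)[OF finite_measure_unit_lebesgue measurable_spectral_value
            AE_spectral_value[OF that] X(2)]) simp
    have sums_\<mu>: "(\<lambda>n. X ^ n * of_real (\<integral>y. y ^ n \<partial>\<mu>)) sums (\<integral>y. 1 / (1 - X * of_real y) \<partial>\<mu>)"
      using geometric_moments_sums(1)[OF \<mu>.finite_measure_axioms _ AE_B X(1)] B(1) \<mu>(2)
      by (simp add: measurable_ident_sets)
    \<comment> \<open>The power series of the atom at 0.\<close>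
    have "(\<lambda>n. if n = 0 then 1 / 2 else (0 :: complex)) sums (1 / 2)"
      using sums_single[of 0 "\<lambda>_. 1 / 2 :: complex"] by simp
    note sums_add[OF this sums_divide[OF sums_add[OF sums_e[of 1] sums_e[of "-1"]], of 4]]
    moreover have "(if n = 0 then 1 / 2 else 0) +
        (X ^ n * of_real (\<integral>y. spectral_value 1 t y ^ n \<partial>unit_lebesgue) +
         X ^ n * of_real (\<integral>y. spectral_value (-1) t y ^ n \<partial>unit_lebesgue)) / 4 =
        X ^ n * of_real (\<integral>y. y ^ n \<partial>\<mu>)" for n
      unfolding law_moments[OF assms(5)] by (cases "n = 0") (simp_all add: algebra_simps)
    ultimately have sums_pair: "(\<lambda>n. X ^ n * of_real (\<integral>y. y ^ n \<partial>\<mu>)) sums (1 / 2 +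
        ((\<integral>y. 1 / (1 - X * of_real (spectral_value 1 t y)) \<partial>unit_lebesgue) +
         (\<integral>y. 1 / (1 - X * of_real (spectral_value (-1) t y)) \<partial>unit_lebesgue)) / 4)"
      by simp
    have cancel: "4 * P / 4 = P" for P :: complex
      by simp
    have integral: "(\<integral>y. 1 / (1 - X * of_real y) \<partial>\<mu>) = 1 / 2 +
        (2 - X) / (1 - X) * arsinh_quotient ((1 - (of_real t)\<^sup>2) * X\<^sup>2 / (1 - X))"
      using sums_unique2[OF sums_\<mu> sums_pair]
      unfolding integral_spectral_value_pair[OF X(2) nz(3,4)] cancel .
    have cauchy: "cauchy_transform \<mu> \<xi> = (\<integral>y. X * (1 / (1 - X * of_real y)) \<partial>\<mu>)"
      unfolding cauchy_transform_def using nz by (simp add: X_def divide_simps)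
    have Z: "(1 - (of_real t)\<^sup>2) * X\<^sup>2 / (1 - X) = (1 - (of_real t)\<^sup>2) / (\<xi>\<^sup>2 - \<xi>)"
      using nz by (simp add: X_def field_simps power2_eq_square)
    have coeff: "X * ((2 - X) / (1 - X)) = (1 - 2 * \<xi>) / (\<xi> - \<xi>\<^sup>2)"
      using nz by (simp add: X_def divide_simps power2_eq_square) (simp add: algebra_simps)
    have F: "F ((1 - (of_real t)\<^sup>2) / (\<xi>\<^sup>2 - \<xi>)) = arsinh_quotient ((1 - (of_real t)\<^sup>2) / (\<xi>\<^sup>2 - \<xi>))"
    proof (rule \<epsilon>(2))
      \<comment> \<open>Hence \<open>\<xi>\<^sup>2 - \<xi>\<close> is at least as large in modulus
        as \<xi>, which exceeds \<open>C / \<epsilon>\<close>.\<close>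
      have "1 \<le> cmod (\<xi> - 1)"
        using large(1) norm_triangle_ineq2[of \<xi> 1] by simp
      then have "cmod \<xi> * 1 \<le> cmod \<xi> * cmod (\<xi> - 1)"
        by (intro mult_left_mono) auto
      then have "cmod \<xi> \<le> cmod (\<xi>\<^sup>2 - \<xi>)"
        by (simp add: power2_eq_square right_diff_distrib flip: norm_mult)
      with large(4) have "C / \<epsilon> < cmod (\<xi>\<^sup>2 - \<xi>)"
        by linarith
      then have "C < \<epsilon> * cmod (\<xi>\<^sup>2 - \<xi>)"
        using \<epsilon>(1) by (simp add: pos_divide_less_eq mult.commute)
      moreover have "cmod (\<xi>\<^sup>2 - \<xi>) > 0"
        using nz by (simp add: power2_eq_square)
      ultimately show "(1 - (of_real t)\<^sup>2) / (\<xi>\<^sup>2 - \<xi>) \<in> ball 0 \<epsilon>"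
        by (simp add: norm_divide pos_divide_less_eq C_def)
    qed
    show ?thesis
      unfolding cauchy integral_mult_right_zero integral Z F coeff[symmetric]
      by (simp add: distrib_left mult.assoc) (simp add: X_def)
  qed
  then show ?thesis
    unfolding eventually_at_infinity by (intro exI allI impI)
qed

end
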